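(* Let $K\ge 2$, let $1\le N\le M$, let $\lambda>0$, and let the algorithm SPECIAL and the standing assumptions (A1)-(A6) be as described in the context. Consider training on task $K$ started from $\theta_K^0=\theta_{K-1}$, where in each round $\tau$ the server samples a subset $\mathcal S_K^\tau\subseteq\{1,\dots,M\}$ of size $N$ uniformly without replacement and aggregates only those clients, and let $\theta_K^t$ be the global model after $t$ rounds of task $K$. Let $t\ge 1$ and $\epsilon\in(0,1)$. Suppose that for every round $\tau\in\{0,\dots,t-1\}$, every local epoch $e\in\{0,\dots,E-1\}$ and every client $m\in\{1,\dots,M\}$, $$\left\langle\nabla f_{1:K-1}(\theta_K^0),\nabla f_{K,m}(\theta_{K,m}^{\tau,e})\right\rangle\ \ge\ \epsilon\,\left\Vert\nabla f_{1:K-1}(\theta_K^0)\right\Vert\cdot\left\Vert\nabla f_{K,m}(\theta_{K,m}^{\tau,e})\right\Vert ,$$ and that the local and global learning rates satisfy $$\gamma_L\le\frac{2\epsilon\left\Vert\nabla f_{1:K-1}(\theta_K^0)\right\Vert}{BLEt\sqrt{ME\cdot\frac{1}{\lambda^2+2\lambda}}},\qquad \gamma_G\le\frac{1}{\sqrt N\,(K-1)} .$$ Then $$\mathbb E_t\left[f_{1:K-1}(\theta_K^t)\right]\ \le\ f_{1:K-1}(\theta_K^0)+\frac{2\epsilon^2\sigma_L^2\left\Vert\nabla f_{1:K-1}(\theta_K^0)\right\Vert^2}{(K-1)\,t\,E\,M\,N\,L\,B^2},$$ where the expectation is over client sampling and data stochasticity during task $K$ (with $\theta_K^0$ given).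
   Context: Problem. There are $K$ tasks and $M$ clients. Client $m$ has local data distribution $\mathcal T_{i,m}$ for task $i$ and local (possibly non-convex) differentiable loss $f_{i,m}(\theta)=\mathbb E_{\xi\sim\mathcal T_{i,m}}[f_{i,m}(\theta,\xi)]$, $\theta\in\mathbb R^d$. Set $f_i=\frac1M\sum_{m=1}^M f_{i,m}$ and $f_{1:k}=\sum_{i=1}^k f_i$. Algorithm SPECIAL (parameters: proximal weight $\lambda>0$, local/global learning rates $\gamma_L,\gamma_G>0$, local epochs $E\ge1$, rounds $T\ge1$ per task, participating clients $N\le M$). Start from $\theta_0\in\mathbb R^d$. For each task $i=1,\dots,K$: set $\theta_i^0=\theta_{i-1}$; for each round $t=0,1,\dots,T-1$: the server samples $\mathcal S_i^t\subseteq\{1,\dots,M\}$ with $|\mathcal S_i^t|=N$, uniformly without replacement; each client $m\in\mathcal S_i^t$ sets $\theta_{i,m}^{t,0}=\theta_i^t$ and for $e=0,\dots,E-1$ computes the stochastic gradient $g_{i,m}^{t,e}=\nabla f_{i,m}(\theta_{i,m}^{t,e},\xi_{i,m}^{t,e})$ on a random sample $\xi_{i,m}^{t,e}$ from $\mathcal T_{i,m}$ and updates $\theta_{i,m}^{t,e+1}=\theta_{i,m}^{t,e}-\gamma_L g_{i,m}^{t,e}$; it sends $\Delta_{i,m}^t=\theta_{i,m}^{t,E}-\theta_{i,m}^{t,0}=-\gamma_L\sum_{e=0}^{E-1}g_{i,m}^{t,e}$. The server forms $\Delta_i^t=\frac1N\sum_{m\in\mathcal S_i^t}\Delta_{i,m}^t$,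 $\bar\theta_i^{t+1}=\theta_i^t+\gamma_G\Delta_i^t$, and $\theta_i^{t+1}=\frac{1}{1+\lambda}\bar\theta_i^{t+1}+\frac{\lambda}{1+\lambda}\theta_{i-1}$. Finally $\theta_i=\theta_i^T$. The local iterates $\theta_{i,m}^{t,e}$ of non-selected clients are defined by the same local recursion (performed virtually). Standing assumptions (for all tasks $i,j$, clients $m$, rounds and local steps): (A1) Bounded gradients: $\|\nabla f_{i,m}(\theta,\xi)\|\le B$ for all $\theta\in\mathbb R^d$ and all samples $\xi$ of $\mathcal T_{i,m}$. (A2) $L$-smoothness: $\|\nabla f_{i,m}(\theta)-\nabla f_{i,m}(\theta')\|\le L\|\theta-\theta'\|$ for all $\theta,\theta'$. (A3) Unbiasedness: the stochastic gradient computed at a (local) iterate on a random sample has expectation (given that iterate) equal to the true local gradient $\nabla f_{i,m}$ at that iterate. (A4) Bounded local variance: the expected squared norm of the difference between the stochastic gradient and the true local gradient at a (local) iterate is at most $\sigma_L^2$. (A5) Bounded intra-task difference: $\|\nabla f_{i,m}(\theta_i^t)-\nabla f_i(\theta_i^t)\|^2\le\sigma_G^2$. (A6) Bounded inter-task difference: $\|\nabla f_i(\theta)-\nabla f_j(\theta)\|^2\le\sigma_T^2$ for all $\theta\in\mathbb R^d$. *)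

theory Defs
  imports "HOL-Probability.Probability"
begin

definition grad :: "('a::euclidean_space \<Rightarrow> real) \<Rightarrow> 'a \<Rightarrow> 'a" where
  "grad F x = (THE D. GDERIV F x :> D)"

text \<open>
  An instance of the federated continual learning problem together with the parameters of SPECIAL.
  Tasks and clients are numbered from 1, rounds and local epochs from 0.
  Throughout, \<open>i\<close> is a task, \<open>m\<close> a client, \<open>t\<close> a round and \<open>e\<close> a local epoch.
\<close>

record ('a, 's) special =
  num_tasks :: nat
  num_clients :: nat
  num_participants :: nat
  num_epochs :: nat
  num_rounds :: nat
  prox_weight :: real
  local_lr :: real
  global_lr :: real
  init_model :: 'a
  data_distr :: "nat \<Rightarrow> nat \<Rightarrow> 's measure"
  sample_loss :: "nat \<Rightarrow> nat \<Rightarrow> 'a \<Rightarrow> 's \<Rightarrow> real"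

definition local_loss :: "('a, 's) special \<Rightarrow> nat \<Rightarrow> nat \<Rightarrow> 'a \<Rightarrow> real" where
  "local_loss P i m \<theta> = (\<integral>\<xi>. sample_loss P i m \<theta> \<xi> \<partial>data_distr P i m)"

definition task_loss :: "('a, 's) special \<Rightarrow> nat \<Rightarrow> 'a \<Rightarrow> real" where
  "task_loss P i \<theta> = (1 / real (num_clients P)) * (\<Sum>m=1..num_clients P. local_loss P i m \<theta>)"

definition cumulative_loss :: "('a, 's) special \<Rightarrow> nat \<Rightarrow> 'a \<Rightarrow> real" where
  "cumulative_loss P k \<theta> = (\<Sum>i=1..k. task_loss P i \<theta>)"

definition stoch_grad :: "('a::euclidean_space, 's) special \<Rightarrow> nat \<Rightarrow> nat \<Rightarrow> 'a \<Rightarrow> 's \<Rightarrow> 'a" where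
  "stoch_grad P i m \<theta> \<xi> = grad (\<lambda>x. sample_loss P i m x \<xi>) \<theta>"

text \<open>
  The random choices made while training on one task: the client set sampled in each round, and the
  data sample \<open>\<xi> (t, m, e)\<close> drawn in round \<open>t\<close> by client \<open>m\<close> at local epoch \<open>e\<close>.
  Samples are drawn for all clients, selected or not, since the non-selected ones perform
  their local updates virtually. All choices are independent of one another.
\<close>

type_synonym 's draws = "(nat \<Rightarrow> nat set) \<times> (nat \<times> nat \<times> nat \<Rightarrow> 's)"

definition draws_measure :: "('a, 's) special \<Rightarrow> nat \<Rightarrow> 's draws measure" where
  "draws_measure P i =
     (\<Pi>\<^sub>M t\<in>{..<num_rounds P}.
        uniform_count_measure {S. S \<subseteq> {1..num_clients P} \<and> card S = num_participants P})
     \<Otimes>\<^sub>M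
     (\<Pi>\<^sub>M (t, m, e)\<in>{..<num_rounds P} \<times> {1..num_clients P} \<times> {..<num_epochs P}. data_distr P i m)"

primrec local_sgd ::
    "('a::euclidean_space, 's) special \<Rightarrow> nat \<Rightarrow> nat \<Rightarrow> (nat \<Rightarrow> 's) \<Rightarrow> 'a \<Rightarrow> nat \<Rightarrow> 'a" where
  "local_sgd P i m \<xi> \<theta> 0 = \<theta>"
| "local_sgd P i m \<xi> \<theta> (Suc e) =
     local_sgd P i m \<xi> \<theta> e - local_lr P *\<^sub>R stoch_grad P i m (local_sgd P i m \<xi> \<theta> e) (\<xi> e)"

text \<open>
  The global model after the given number of rounds of task \<open>i\<close>, started from
  (and pulled back towards) the final model \<open>\<theta>'\<close> of the previous task.
\<close>

primrec task_model ::
    "('a::euclidean_space, 's) special \<Rightarrow> nat \<Rightarrow> 's draws \<Rightarrow> 'a \<Rightarrow> nat \<Rightarrow> 'a" where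
  "task_model P i \<kappa> \<theta>' 0 = \<theta>'"
| "task_model P i \<kappa> \<theta>' (Suc t) =
     (let \<theta> = task_model P i \<kappa> \<theta>' t;
          \<Delta>\<^sub>c = (\<lambda>m. local_sgd P i m (\<lambda>e. snd \<kappa> (t, m, e)) \<theta> (num_epochs P) - \<theta>);
          \<Delta> = (1 / real (num_participants P)) *\<^sub>R (\<Sum>m\<in>fst \<kappa> t. \<Delta>\<^sub>c m);
          \<theta>\<^sub>b = \<theta> + global_lr P *\<^sub>R \<Delta>
      in (1 / (1 + prox_weight P)) *\<^sub>R \<theta>\<^sub>b + (prox_weight P / (1 + prox_weight P)) *\<^sub>R \<theta>')"

text \<open>
  A run of SPECIAL is determined by the random choices \<open>\<omega> i\<close> made during each task \<open>i\<close>.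
  The following are \<open>\<theta>\<^sub>i\<close>, \<open>\<theta>\<^sub>i\<^sup>t\<close> and \<open>\<theta>\<^sub>i\<^sub>,\<^sub>m\<close> at \<open>(t, e)\<close>; the last two are meant for tasks \<open>i \<ge> 1\<close>.
\<close>

primrec final_model :: "('a::euclidean_space, 's) special \<Rightarrow> (nat \<Rightarrow> 's draws) \<Rightarrow> nat \<Rightarrow> 'a" where
  "final_model P \<omega> 0 = init_model P"
| "final_model P \<omega> (Suc i) =
     task_model P (Suc i) (\<omega> (Suc i)) (final_model P \<omega> i) (num_rounds P)"

definition global_model ::
    "('a::euclidean_space, 's) special \<Rightarrow> (nat \<Rightarrow> 's draws) \<Rightarrow> nat \<Rightarrow> nat \<Rightarrow> 'a" where
  "global_model P \<omega> i t = task_model P i (\<omega> i) (final_model P \<omega> (i - 1)) t"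

definition local_model ::
    "('a::euclidean_space, 's) special \<Rightarrow> (nat \<Rightarrow> 's draws) \<Rightarrow> nat \<Rightarrow> nat \<Rightarrow> nat \<Rightarrow> nat \<Rightarrow> 'a" where
  "local_model P \<omega> i m t e =
     local_sgd P i m (\<lambda>e. snd (\<omega> i) (t, m, e)) (global_model P \<omega> i t) e"

text \<open>
  The two conditions refer to a fresh sample \<open>\<xi>\<close> at a given iterate \<open>\<theta>\<close>, i.e. they are the
  conditional moments of the stochastic gradient given that iterate.
\<close>

definition unbiased_at :: "('a::euclidean_space, 's) special \<Rightarrow> nat \<Rightarrow> nat \<Rightarrow> 'a \<Rightarrow> bool" where
  "unbiased_at P i m \<theta> \<longleftrightarrow>
     (\<integral>\<xi>. stoch_grad P i m \<theta> \<xi> \<partial>data_distr P i m) = grad (local_loss P i m) \<theta>"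

definition variance_bounded_at ::
    "('a::euclidean_space, 's) special \<Rightarrow> real \<Rightarrow> nat \<Rightarrow> nat \<Rightarrow> 'a \<Rightarrow> bool" where
  "variance_bounded_at P \<sigma> i m \<theta> \<longleftrightarrow>
     (\<integral>\<xi>. (norm (stoch_grad P i m \<theta> \<xi> - grad (local_loss P i m) \<theta>))\<^sup>2 \<partial>data_distr P i m) \<le> \<sigma>\<^sup>2"

end

theory Submission
  imports Defs
begin

text \<open>
  Write \<open>u = \<nabla>f\<^sub>1\<^sub>:\<^sub>K\<^sub>-\<^sub>1(\<theta>\<^sub>K\<^sub>0)\<close> and \<open>\<gamma> = \<gamma>\<^sub>G \<gamma>\<^sub>L\<close>. Unrolling the proximal recursion,
  the displacement of the global model after \<open>t\<close> rounds is \<open>-\<gamma>\<close> times a combination of all stochastic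
  gradients \<open>g\<close> used, with weights \<open>(1 + \<lambda>)^(\<tau> - t) / N\<close> of total mass \<open>A E\<close>, where
  \<open>A = (\<Sum>\<tau><t. (1 + \<lambda>)^(\<tau> - t))\<close>. The smoothness inequality and the weighted Cauchy-Schwarz inequality
  bound the increase of the old loss by \<open>\<gamma>\<close> times the same combination of \<open>c |g|\<^sup>2 - \<langle>u, g\<rangle>\<close>, for a
  constant \<open>c\<close> proportional to \<open>\<gamma> A E\<close>. A sample is independent of the iterate at which it is used,
  so the conditional mean of such a term is at most \<open>c \<sigma>\<^sub>L\<^sup>2 + c |\<nabla>f|\<^sup>2 - \<langle>u, \<nabla>f\<rangle>\<close>. By alignment and
  \<open>c B \<le> \<epsilon> |u|\<close>, which the learning rates ensure, the gradient part is nonpositive, and only the noise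
  \<open>\<gamma> A E c \<sigma>\<^sub>L\<^sup>2\<close> remains; it is evaluated with \<open>A\<^sup>2 \<le> t / (\<lambda>\<^sup>2 + 2 \<lambda>)\<close>.
\<close>

subsection \<open>Gradients and smoothness\<close>

text \<open>\<open>grad\<close> is a definite description, so existence and uniqueness are both at
  stake. The derivative is linear, hence it is the inner product with the vector built from its
  values on \<open>Basis\<close>; two gradients induce the same derivative and therefore
  coincide.\<close>

lemma gderiv_grad:
  fixes F :: "'a::euclidean_space \<Rightarrow> real"
  assumes "F differentiable (at x)"
  shows "GDERIV F x :> grad F x"
proof -
  obtain F' where F': "(F has_derivative F') (at x)"
    using assms by (auto simp: differentiable_def)
  interpret linear F'
    using F' has_derivative_linear by blast
  have "F' h = h \<bullet> (\<Sum>b\<in>Basis. F' b *\<^sub>R b)" for h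
    by (subst euclidean_representation[of h, symmetric])
       (simp add: sum scaleR inner_sum_right inner_commute mult.commute)
  then have D: "GDERIV F x :> (\<Sum>b\<in>Basis. F' b *\<^sub>R b)"
    unfolding gderiv_def by (intro has_derivative_subst[OF F'] ext)
  moreover have "D' = D" if "GDERIV F x :> D'" "GDERIV F x :> D" for D D'
    using has_derivative_unique[OF that[unfolded gderiv_def]]
    by (metis inner_commute vector_eq_rdot)
  ultimately show ?thesis
    unfolding grad_def by (metis theI)
qed

lemma grad_eqI:
  fixes F :: "'a::euclidean_space \<Rightarrow> real"
  assumes "GDERIV F x :> D"
  shows "grad F x = D"
proof -
  have "GDERIV F x :> grad F x"
    using assms by (intro gderiv_grad) (auto simp: gderiv_def differentiable_def)
  from has_derivative_unique[OF this[unfolded gderiv_def] assms[unfolded gderiv_def]]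
  show ?thesis
    by (metis inner_commute vector_eq_rdot)
qed

lemma gderiv_sum:
  assumes "\<And>i. i \<in> I \<Longrightarrow> GDERIV (f i) x :> D i"
  shows "GDERIV (\<lambda>x. \<Sum>i\<in>I. f i x) x :> (\<Sum>i\<in>I. D i)"
  using assms unfolding gderiv_def inner_sum_right by (intro has_derivative_sum)

lemma gderiv_cmult:
  assumes "GDERIV f x :> D"
  shows "GDERIV (\<lambda>x. c * f x) x :> c *\<^sub>R D"
  using assms unfolding gderiv_def inner_scaleR_right by (intro has_derivative_mult_right)

text \<open>The descent lemma, obtained from monotonicity along the segment from \<open>x\<close> to
  \<open>y\<close> instead of integrating the gradient.\<close>

lemma smooth_upper_bound:
  fixes F :: "'a::real_inner \<Rightarrow> real"
  assumes F: "\<And>x. GDERIV F x :> F' x"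
    and smooth: "\<And>x y. norm (F' x - F' y) \<le> C * norm (x - y)"
  shows "F y \<le> F x + F' x \<bullet> (y - x) + C / 2 * (norm (y - x))\<^sup>2"
proof -
  define d where "d = y - x"
  \<comment> \<open>Up to the constant \<open>F x\<close>, this is \<open>F\<close> on the segment
    minus the bound to be proved, so the claim reads \<open>\<phi> 1 \<le> \<phi> 0\<close>.\<close>
  define \<phi> where "\<phi> s = F (x + s *\<^sub>R d) - s * (F' x \<bullet> d) - C / 2 * s\<^sup>2 * (norm d)\<^sup>2" for s :: real
  have "\<exists>l. DERIV \<phi> s :> l \<and> l \<le> 0" if "0 \<le> s" for s
  proof -
    let ?l = "d \<bullet> F' (x + s *\<^sub>R d) - F' x \<bullet> d - C * s * (norm d)\<^sup>2"
    have "((\<lambda>s. F (x + s *\<^sub>R d)) has_derivative (\<lambda>h. (h *\<^sub>R d) \<bullet> F' (x + s *\<^sub>R d))) (at s)"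
      by (rule has_derivative_compose[OF _ F[unfolded gderiv_def]]) (auto intro!: derivative_eq_intros)
    then have "DERIV (\<lambda>s. F (x + s *\<^sub>R d)) s :> d \<bullet> F' (x + s *\<^sub>R d)"
      by (simp add: has_field_derivative_def mult.commute[of _ "d \<bullet> _"])
    then have "DERIV \<phi> s :> ?l"
      unfolding \<phi>_def by (auto intro!: derivative_eq_intros)
    moreover have "?l \<le> 0"
    proof -
      have "d \<bullet> F' (x + s *\<^sub>R d) - F' x \<bullet> d = (F' (x + s *\<^sub>R d) - F' x) \<bullet> d"
        by (simp add: inner_diff_left inner_diff_right inner_commute[of _ d])
      also have "\<dots> \<le> norm (F' (x + s *\<^sub>R d) - F' x) * norm d"
        by (rule norm_cauchy_schwarz)
      also have "\<dots> \<le> C * norm (s *\<^sub>R d) * norm d"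
        using smooth[of "x + s *\<^sub>R d" x] by (intro mult_right_mono) auto
      finally show ?thesis
        using that by (simp add: power2_eq_square mult_ac)
    qed
    ultimately show ?thesis
      by blast
  qed
  then have "\<phi> 1 \<le> \<phi> 0"
    by (intro DERIV_nonpos_imp_nonincreasing[of 0 1 \<phi>]) simp_all
  then show ?thesis
    by (simp add: \<phi>_def d_def)
qed

text \<open>Cauchy-Schwarz after splitting every weight into two factors
  \<open>sqrt (w i)\<close>.\<close>

lemma norm_weighted_sum_sq_le:
  fixes x :: "'i \<Rightarrow> 'a::real_normed_vector"
  assumes "\<And>i. i \<in> I \<Longrightarrow> 0 \<le> w i"
  shows "(norm (\<Sum>i\<in>I. w i *\<^sub>R x i))\<^sup>2 \<le> (\<Sum>i\<in>I. w i) * (\<Sum>i\<in>I. w i * (norm (x i))\<^sup>2)"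
proof -
  have "norm (\<Sum>i\<in>I. w i *\<^sub>R x i) \<le> (\<Sum>i\<in>I. sqrt (w i) * (sqrt (w i) * norm (x i)))"
    using assms by (intro order.trans[OF norm_sum] sum_mono) (simp flip: mult.assoc)
  then have "(norm (\<Sum>i\<in>I. w i *\<^sub>R x i))\<^sup>2 \<le> (\<Sum>i\<in>I. sqrt (w i) * (sqrt (w i) * norm (x i)))\<^sup>2"
    by (intro power_mono) auto
  also have "\<dots> \<le> (\<Sum>i\<in>I. (sqrt (w i))\<^sup>2) * (\<Sum>i\<in>I. (sqrt (w i) * norm (x i))\<^sup>2)"
    by (rule Cauchy_Schwarz_ineq_sum)
  also have "\<dots> = (\<Sum>i\<in>I. w i) * (\<Sum>i\<in>I. w i * (norm (x i))\<^sup>2)"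
    using assms by (simp add: power_mult_distrib)
  finally show ?thesis .
qed

subsection \<open>Measurability and resampling\<close>

text \<open>When a simple function replaces the first argument, only finitely many sections
  \<open>f x\<close> occur, and each is measurable. Simple functions converging to the identity then
  give \<open>f\<close> as a pointwise limit, by continuity in the first argument.\<close>

lemma borel_measurable_Caratheodory:
  fixes f :: "'a::{metric_space, second_countable_topology} \<Rightarrow> 'b \<Rightarrow> 'c::metric_space"
  assumes "\<And>x. f x \<in> borel_measurable M"
    and "\<And>\<xi> x. \<xi> \<in> space M \<Longrightarrow> isCont (\<lambda>x. f x \<xi>) x"
  shows "(\<lambda>(x, \<xi>). f x \<xi>) \<in> borel_measurable (borel \<Otimes>\<^sub>M M)"
proof -
  \<comment> \<open>The identity is approximated by simple functions; \<open>undefined\<close> is an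
    arbitrary base point.\<close>
  obtain s :: "nat \<Rightarrow> 'a \<Rightarrow> 'a"
    where s: "\<And>n. simple_function borel (s n)" "\<And>x. (\<lambda>n. s n x) \<longlonglongrightarrow> x"
    using borel_measurable_implies_sequence_metric[of "\<lambda>x::'a. x" borel undefined, OF measurable_ident_sets[OF refl]]
    by (simp only: space_borel UNIV_I simp_thms ball_UNIV) blast
  show ?thesis
  proof (rule borel_measurable_LIMSEQ_metric)
    fix n
    show "(\<lambda>p. f (s n (fst p)) (snd p)) \<in> borel_measurable (borel \<Otimes>\<^sub>M M)"
    proof (rule measurable_compose_countable'[where I="range (s n)"])
      show "countable (range (s n))"
        using s(1)[of n] by (auto simp: simple_function_def intro: countable_finite)
      have "s n \<in> measurable borel (count_space (range (s n)))"
        using s(1)[of n] by (auto simp: simple_function_def measurable_count_space_eq2)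
      then show "(\<lambda>p. s n (fst p)) \<in> measurable (borel \<Otimes>\<^sub>M M) (count_space (range (s n)))"
        by (rule measurable_compose[OF measurable_fst])
      show "(\<lambda>p. f x (snd p)) \<in> borel_measurable (borel \<Otimes>\<^sub>M M)" for x
        using assms(1)[of x] by measurable
    qed
  next
    fix p :: "'a \<times> 'b" assume "p \<in> space (borel \<Otimes>\<^sub>M M)"
    then show "(\<lambda>n. f (s n (fst p)) (snd p)) \<longlonglongrightarrow> (case p of (x, \<xi>) \<Rightarrow> f x \<xi>)"
      using isCont_tendsto_compose[OF assms(2)[of "snd p" "fst p"] s(2)]
      by (simp add: space_pair_measure case_prod_beta' mem_Times_iff)
  qed
qed

text \<open>
  The assumptions of the theorem do not mention measurability of the stochastic gradients: it comes from
  the differentiability of the sample losses, via limits of difference quotients.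
\<close>

lemma borel_measurable_grad:
  fixes f :: "'a::euclidean_space \<Rightarrow> 'b \<Rightarrow> real"
  assumes f: "\<And>x. f x \<in> borel_measurable M"
    and diff: "\<And>\<xi> x. \<xi> \<in> space M \<Longrightarrow> (\<lambda>x. f x \<xi>) differentiable (at x)"
  shows "(\<lambda>(x, \<xi>). grad (\<lambda>x. f x \<xi>) x) \<in> borel_measurable (borel \<Otimes>\<^sub>M M)"
proof -
  \<comment> \<open>The difference quotients evaluate \<open>f\<close> at points that move with
    \<open>x\<close>, which calls for joint measurability.\<close>
  have [measurable]: "(\<lambda>(x, \<xi>). f x \<xi>) \<in> borel_measurable (borel \<Otimes>\<^sub>M M)"
    using f diff by (intro borel_measurable_Caratheodory differentiable_imp_continuous_within) auto
  have "(\<lambda>p. (case p of (x, \<xi>) \<Rightarrow> grad (\<lambda>x. f x \<xi>) x) \<bullet> b) \<in> borel_measurable (borel \<Otimes>\<^sub>M M)" for b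
  proof (rule borel_measurable_LIMSEQ_real)
    fix n
    show "(\<lambda>p. (f (fst p + (1 / real (Suc n)) *\<^sub>R b) (snd p) - f (fst p) (snd p)) / (1 / real (Suc n)))
        \<in> borel_measurable (borel \<Otimes>\<^sub>M M)"
      by measurable
  next
    fix p :: "'a \<times> 'b" assume p: "p \<in> space (borel \<Otimes>\<^sub>M M)"
    obtain x \<xi> where [simp]: "p = (x, \<xi>)" by (cases p)
    let ?g = "grad (\<lambda>x. f x \<xi>) x"
    have "GDERIV (\<lambda>x. f x \<xi>) (x + 0 *\<^sub>R b) :> ?g"
      using diff[of \<xi> x] p by (auto simp: space_pair_measure intro: gderiv_grad)
    then have "((\<lambda>s. f (x + s *\<^sub>R b) \<xi>) has_derivative (\<lambda>h. (h *\<^sub>R b) \<bullet> ?g)) (at 0)"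
      unfolding gderiv_def by (rule has_derivative_compose[rotated]) (auto intro!: derivative_eq_intros)
    then have "DERIV (\<lambda>s. f (x + s *\<^sub>R b) \<xi>) 0 :> ?g \<bullet> b"
      by (simp add: has_field_derivative_def mult.commute[of _ "b \<bullet> _"] inner_commute[of _ b])
    then have "((\<lambda>s. (f (x + s *\<^sub>R b) \<xi> - f x \<xi>) / s) \<longlongrightarrow> ?g \<bullet> b) (at 0)"
      by (simp add: DERIV_def)
    moreover have "filterlim (\<lambda>n. 1 / real (Suc n)) (at 0) sequentially"
      using LIMSEQ_inverse_real_of_nat by (auto simp: filterlim_at inverse_eq_divide)
    ultimately have "(\<lambda>n. (f (x + (1 / real (Suc n)) *\<^sub>R b) \<xi> - f x \<xi>) / (1 / real (Suc n)))
        \<longlonglongrightarrow> ?g \<bullet> b"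
      by (rule filterlim_compose)
    then show "(\<lambda>n. (f (fst p + (1 / real (Suc n)) *\<^sub>R b) (snd p) - f (fst p) (snd p)) / (1 / real (Suc n)))
        \<longlonglongrightarrow> (case p of (x, \<xi>) \<Rightarrow> grad (\<lambda>x. f x \<xi>) x) \<bullet> b"
      by simp
  qed
  then show ?thesis
    by (subst borel_measurable_euclidean_space) blast
qed

text \<open>Overwriting coordinate \<open>j\<close> by an independent copy preserves the product
  law. Since \<open>f\<close> ignores coordinate \<open>j\<close> of its first argument, the copy
  survives only in the second one, and Fubini integrates it out. This replaces conditioning on
  everything but \<open>X j\<close>.\<close>

lemma integral_PiM_resample:
  fixes f :: "('i \<Rightarrow> 'a) \<Rightarrow> 'a \<Rightarrow> real"
  assumes M: "\<And>i. i \<in> I \<Longrightarrow> prob_space (M i)" and j: "j \<in> I"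
    and f[measurable]: "(\<lambda>(X, y). f X y) \<in> borel_measurable (PiM I M \<Otimes>\<^sub>M M j)"
    and bounded: "\<And>X y. X \<in> space (PiM I M) \<Longrightarrow> y \<in> space (M j) \<Longrightarrow> \<bar>f X y\<bar> \<le> C"
    and indep: "\<And>X x y. X \<in> space (PiM I M) \<Longrightarrow> x \<in> space (M j) \<Longrightarrow> y \<in> space (M j) \<Longrightarrow>
      f (X(j := x)) y = f X y"
  shows "(\<integral>X. f X (X j) \<partial>PiM I M) = (\<integral>X. \<integral>y. f X y \<partial>M j \<partial>PiM I M)"
proof -
  interpret D: prob_space "M j" by (rule M[OF j])
  interpret \<Pi>: prob_space "PiM I M" by (rule prob_space_PiM[OF M])
  interpret pair_prob_space "M j" "PiM I M" ..
  \<comment> \<open>Here \<open>X(j := x)\<close> overwrites a coordinate already present, whereas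
    the library fact is phrased with the index set \<open>insert j I\<close>.\<close>
  have insert: "insert j I = I" using j by blast
  have distr: "distr (M j \<Otimes>\<^sub>M PiM I M) (PiM I M) (\<lambda>(x, X). X(j := x)) = PiM I M"
    using distr_pair_PiM_eq_PiM[of I M j] M j by (simp add: insert)
  have [measurable]: "(\<lambda>(x, X). X(j := x)) \<in> measurable (M j \<Otimes>\<^sub>M PiM I M) (PiM I M)"
    by (rule measurable_cong[THEN iffD1, OF _ measurable_fun_upd[where J=I and i=j and f=snd and h=fst]])
       (use j in auto)
  have [measurable]: "(\<lambda>X. X j) \<in> measurable (PiM I M) (M j)"
    using j by measurable
  have [measurable]: "(\<lambda>X. f X (X j)) \<in> borel_measurable (PiM I M)"
    using measurable_compose[OF measurable_Pair[OF measurable_ident_sets[OF refl] \<open>(\<lambda>X. X j) \<in> _\<close>] f]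
    by simp
  have "(\<integral>X. f X (X j) \<partial>PiM I M) = (\<integral>X. f X (X j) \<partial>distr (M j \<Otimes>\<^sub>M PiM I M) (PiM I M) (\<lambda>(x, X). X(j := x)))"
    by (simp add: distr)
  also have "\<dots> = (\<integral>p. f ((snd p)(j := fst p)) (fst p) \<partial>(M j \<Otimes>\<^sub>M PiM I M))"
    by (subst integral_distr) (auto simp: case_prod_beta')
  also have "\<dots> = (\<integral>p. f (snd p) (fst p) \<partial>(M j \<Otimes>\<^sub>M PiM I M))"
    by (intro Bochner_Integration.integral_cong) (auto simp: space_pair_measure indep)
  also have "\<dots> = (\<integral>X. \<integral>y. f X y \<partial>M j \<partial>PiM I M)"
  proof -
    have "integrable (M j \<Otimes>\<^sub>M PiM I M) (\<lambda>(y, X). f X y)"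
      by (rule finite_measure.integrable_const_bound[where B=C])
         (auto simp: space_pair_measure bounded intro!: AE_I2 finite_measure_axioms)
    from integral_snd[OF this] show ?thesis
      by (simp add: case_prod_beta')
  qed
  finally show ?thesis .
qed

subsection \<open>The run of a single task\<close>

text \<open>The strict bound matters: iterate \<open>e\<close> is formed before sample
  \<open>e\<close> is used. Together with the analogous fact about rounds, this is why a sample is
  fresh at its iterate.\<close>

lemma local_sgd_cong:
  assumes "\<And>k. k < e \<Longrightarrow> \<xi> k = \<xi>' k"
  shows "local_sgd P i m \<xi> \<theta> e = local_sgd P i m \<xi>' \<theta> e"
  using assms by (induction e) auto

lemma task_model_cong:
  assumes "\<And>\<tau>. \<tau> < t \<Longrightarrow> fst \<kappa> \<tau> = fst \<kappa>' \<tau>"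
    and "\<And>\<tau> m e. \<tau> < t \<Longrightarrow> snd \<kappa> (\<tau>, m, e) = snd \<kappa>' (\<tau>, m, e)"
  shows "task_model P i \<kappa> \<theta>' t = task_model P i \<kappa>' \<theta>' t"
  using assms by (induction t) (simp_all add: Let_def)

lemma final_model_cong:
  assumes "\<And>i. i \<in> {1..k} \<Longrightarrow> \<omega> i = \<omega>' i"
  shows "final_model P \<omega> k = final_model P \<omega>' k"
  using assms by (induction k) auto

lemma local_sgd_eq_sum:
  "local_sgd P i m \<xi> \<theta> e - \<theta> =
    - local_lr P *\<^sub>R (\<Sum>k<e. stoch_grad P i m (local_sgd P i m \<xi> \<theta> k) (\<xi> k))"
  by (induction e) (auto simp: algebra_simps)

text \<open>One task in isolation: the randomness of all earlier tasks is condensed in the fixed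
  model \<open>\<theta>'\<close>, which is both the start and the proximal anchor.\<close>

locale special_task =
  fixes P :: "('a::euclidean_space, 's) special" and i :: nat and B :: real and \<theta>' :: 'a
  assumes participants: "1 \<le> num_participants P" "num_participants P \<le> num_clients P"
    and prob_data: "\<And>m. m \<in> {1..num_clients P} \<Longrightarrow> prob_space (data_distr P i m)"
    and loss_measurable: "\<And>m \<theta>. m \<in> {1..num_clients P} \<Longrightarrow>
      sample_loss P i m \<theta> \<in> borel_measurable (data_distr P i m)"
    and loss_differentiable: "\<And>m \<theta> \<xi>. m \<in> {1..num_clients P} \<Longrightarrow>
      \<xi> \<in> space (data_distr P i m) \<Longrightarrow> (\<lambda>x. sample_loss P i m x \<xi>) differentiable (at \<theta>)"
    and stoch_grad_bound: "\<And>m \<theta> \<xi>. m \<in> {1..num_clients P} \<Longrightarrow>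
      \<xi> \<in> space (data_distr P i m) \<Longrightarrow> norm (stoch_grad P i m \<theta> \<xi>) \<le> B"
begin

abbreviation "clients \<equiv> {1..num_clients P}"
abbreviation "\<Omega> \<equiv> draws_measure P i"

definition client_sets_measure :: "(nat \<Rightarrow> nat set) measure" where
  "client_sets_measure = (\<Pi>\<^sub>M t\<in>{..<num_rounds P}.
     uniform_count_measure {S. S \<subseteq> clients \<and> card S = num_participants P})"

definition samples_measure :: "(nat \<times> nat \<times> nat \<Rightarrow> 's) measure" where
  "samples_measure = (\<Pi>\<^sub>M (t, m, e)\<in>{..<num_rounds P} \<times> clients \<times> {..<num_epochs P}. data_distr P i m)"

text \<open>Depends on the draws of the current task alone. The client set of round
  \<open>\<tau>\<close> does not enter, so the virtual updates of non-selected clients are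
  covered.\<close>

definition local_iterate :: "'s draws \<Rightarrow> nat \<Rightarrow> nat \<Rightarrow> nat \<Rightarrow> 'a" where
  "local_iterate \<kappa> \<tau> m e =
     local_sgd P i m (\<lambda>e. snd \<kappa> (\<tau>, m, e)) (task_model P i \<kappa> \<theta>' \<tau>) e"

definition step_grad :: "'s draws \<Rightarrow> nat \<Rightarrow> nat \<Rightarrow> nat \<Rightarrow> 'a" where
  "step_grad \<kappa> \<tau> m e = stoch_grad P i m (local_iterate \<kappa> \<tau> m e) (snd \<kappa> (\<tau>, m, e))"

lemma draws_measure_eq: "\<Omega> = client_sets_measure \<Otimes>\<^sub>M samples_measure"
  by (simp add: draws_measure_def client_sets_measure_def samples_measure_def)

lemma prob_space_client_sets: "prob_space client_sets_measure"
proof -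
  have "{S. S \<subseteq> clients \<and> card S = num_participants P} \<noteq> {}"
    using participants obtain_subset_with_card_n[of "num_participants P" clients] by auto
  then show ?thesis
    unfolding client_sets_measure_def
    by (intro prob_space_PiM prob_space_uniform_count_measure) auto
qed

lemma prob_space_samples: "prob_space samples_measure"
  unfolding samples_measure_def using prob_data by (intro prob_space_PiM) auto

lemma prob_space_draws: "prob_space \<Omega>"
proof -
  interpret C: prob_space client_sets_measure by (rule prob_space_client_sets)
  interpret S: prob_space samples_measure by (rule prob_space_samples)
  interpret pair_prob_space client_sets_measure samples_measure ..
  show ?thesis
    unfolding draws_measure_eq by (rule prob_space_axioms)
qed

lemma space_drawsD:
  assumes "\<kappa> \<in> space \<Omega>" "\<tau> < num_rounds P"
  shows "fst \<kappa> \<tau> \<subseteq> clients" "card (fst \<kappa> \<tau>) = num_participants P"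
    and "\<And>m e. m \<in> clients \<Longrightarrow> e < num_epochs P \<Longrightarrow> snd \<kappa> (\<tau>, m, e) \<in> space (data_distr P i m)"
  using assms
  by (auto simp: draws_measure_def space_pair_measure space_PiM space_uniform_count_measure
    PiE_def Pi_def subset_iff)

section \<open>Measurability of the iterates as functions of the draws\<close>

lemma measurable_sample [measurable]:
  assumes "\<tau> < num_rounds P" "m \<in> clients" "e < num_epochs P"
  shows "(\<lambda>\<kappa>. snd \<kappa> (\<tau>, m, e)) \<in> measurable \<Omega> (data_distr P i m)"
proof -
  have "(\<lambda>X. X (\<tau>, m, e)) \<in> measurable samples_measure
      (case (\<tau>, m, e) of (t, m, e) \<Rightarrow> data_distr P i m)"
    unfolding samples_measure_def by (rule measurable_component_singleton) (use assms in auto)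
  then show ?thesis
    unfolding draws_measure_eq by (intro measurable_compose[OF measurable_snd]) simp
qed

lemma measurable_client_selected [measurable]:
  assumes "\<tau> < num_rounds P"
  shows "Measurable.pred \<Omega> (\<lambda>\<kappa>. m \<in> fst \<kappa> \<tau>)"
proof -
  let ?U = "uniform_count_measure {S. S \<subseteq> clients \<and> card S = num_participants P}"
  have "(\<lambda>s. s \<tau>) \<in> measurable client_sets_measure ?U"
    unfolding client_sets_measure_def by (rule measurable_component_singleton) (use assms in auto)
  then have "(\<lambda>\<kappa>. fst \<kappa> \<tau>) \<in> measurable \<Omega> ?U"
    unfolding draws_measure_eq by (intro measurable_compose[OF measurable_fst])
  moreover have "Measurable.pred ?U (\<lambda>S. m \<in> S)"
    by (simp add: pred_def sets_uniform_count_measure) (auto simp: space_uniform_count_measure)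
  ultimately show ?thesis
    by (rule measurable_compose)
qed

lemma measurable_stoch_grad:
  assumes "m \<in> clients"
  shows "(\<lambda>(\<theta>, \<xi>). stoch_grad P i m \<theta> \<xi>) \<in> borel_measurable (borel \<Otimes>\<^sub>M data_distr P i m)"
  unfolding stoch_grad_def using assms loss_measurable loss_differentiable
  by (intro borel_measurable_grad)

lemma measurable_stoch_grad_compose:
  assumes "m \<in> clients" "f \<in> borel_measurable X" "g \<in> measurable X (data_distr P i m)"
  shows "(\<lambda>x. stoch_grad P i m (f x) (g x)) \<in> borel_measurable X"
  using measurable_compose[OF measurable_Pair[OF assms(2,3)] measurable_stoch_grad[OF assms(1)]]
  by simp

text \<open>The start \<open>w\<close> is arbitrary because this is applied inside the induction
  that proves the global model measurable.\<close>

lemma measurable_local_sgd: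
  assumes "w \<in> borel_measurable \<Omega>" "\<tau> < num_rounds P" "m \<in> clients" "e \<le> num_epochs P"
  shows "(\<lambda>\<kappa>. local_sgd P i m (\<lambda>e. snd \<kappa> (\<tau>, m, e)) (w \<kappa>) e) \<in> borel_measurable \<Omega>"
  using assms(4)
proof (induction e)
  case (Suc e)
  then have [measurable]:
      "(\<lambda>\<kappa>. local_sgd P i m (\<lambda>e. snd \<kappa> (\<tau>, m, e)) (w \<kappa>) e) \<in> borel_measurable \<Omega>"
    by simp
  from measurable_stoch_grad_compose[OF assms(3) this measurable_sample[OF assms(2,3)]] Suc.prems
  have [measurable]: "(\<lambda>\<kappa>. stoch_grad P i m (local_sgd P i m (\<lambda>e. snd \<kappa> (\<tau>, m, e)) (w \<kappa>) e)
      (snd \<kappa> (\<tau>, m, e))) \<in> borel_measurable \<Omega>"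
    by simp
  show ?case
    by simp
qed (simp add: assms(1))

lemma measurable_task_model:
  assumes "t \<le> num_rounds P"
  shows "(\<lambda>\<kappa>. task_model P i \<kappa> \<theta>' t) \<in> borel_measurable \<Omega>"
  using assms
proof (induction t)
  case (Suc t)
  then have [measurable]: "(\<lambda>\<kappa>. task_model P i \<kappa> \<theta>' t) \<in> borel_measurable \<Omega>"
    and t [measurable]: "t < num_rounds P"
    by auto
  define d where "d \<kappa> m =
    local_sgd P i m (\<lambda>e. snd \<kappa> (t, m, e)) (task_model P i \<kappa> \<theta>' t) (num_epochs P)
      - task_model P i \<kappa> \<theta>' t" for \<kappa> m
  have [measurable]: "(\<lambda>\<kappa>. d \<kappa> m) \<in> borel_measurable \<Omega>" if "m \<in> clients" for m
    unfolding d_def using that t by (intro borel_measurable_diff measurable_local_sgd) auto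
  \<comment> \<open>The index set is random; summing over all clients with a selection indicator
    makes it fixed.\<close>
  have "(\<lambda>\<kappa>. \<Sum>m\<in>fst \<kappa> t. d \<kappa> m) \<in> borel_measurable \<Omega>"
  proof (rule measurable_cong[THEN iffD1])
    show "(\<lambda>\<kappa>. \<Sum>m\<in>clients. if m \<in> fst \<kappa> t then d \<kappa> m else 0) \<in> borel_measurable \<Omega>"
      using t by (intro borel_measurable_sum measurable_If) auto
    show "(\<Sum>m\<in>clients. if m \<in> fst \<kappa> t then d \<kappa> m else 0) = (\<Sum>m\<in>fst \<kappa> t. d \<kappa> m)"
      if "\<kappa> \<in> space \<Omega>" for \<kappa>
      using space_drawsD(1)[OF that t] by (subst sum.inter_restrict[symmetric]) (auto simp: Int_absorb1)
  qed
  then show ?case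
    by (simp add: Let_def d_def)
qed simp

lemma measurable_local_iterate:
  assumes "\<tau> < num_rounds P" "m \<in> clients" "e \<le> num_epochs P"
  shows "(\<lambda>\<kappa>. local_iterate \<kappa> \<tau> m e) \<in> borel_measurable \<Omega>"
  unfolding local_iterate_def using assms by (intro measurable_local_sgd measurable_task_model) auto

lemma measurable_step_grad:
  assumes "\<tau> < num_rounds P" "m \<in> clients" "e < num_epochs P"
  shows "(\<lambda>\<kappa>. step_grad \<kappa> \<tau> m e) \<in> borel_measurable \<Omega>"
  unfolding step_grad_def using assms
  by (intro measurable_stoch_grad_compose measurable_local_iterate measurable_sample) auto

text \<open>The iterate is built from rounds before \<open>\<tau>\<close> and, in round
  \<open>\<tau>\<close>, from the samples of client \<open>m\<close> at epochs before
  \<open>e\<close>; the coordinate \<open>(\<tau>, m, e)\<close> is not among them.\<close>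

lemma local_iterate_update:
  "local_iterate (s, X((\<tau>, m, e) := x)) \<tau> m e = local_iterate (s, X) \<tau> m e"
  unfolding local_iterate_def
  by (subst local_sgd_cong[where \<xi>' = "\<lambda>e. X (\<tau>, m, e)"])
     (auto intro!: arg_cong[where f = "\<lambda>\<theta>. local_sgd P i m _ \<theta> e"] task_model_cong)

lemma step_grad_bound:
  assumes "\<kappa> \<in> space \<Omega>" "\<tau> < num_rounds P" "m \<in> clients" "e < num_epochs P"
  shows "norm (step_grad \<kappa> \<tau> m e) \<le> B"
  unfolding step_grad_def using assms space_drawsD by (intro stoch_grad_bound) auto

subsection \<open>Fresh samples\<close>

text \<open>The tower property without a filtration: for frozen client sets, neither the iterate nor
  the selection indicator depends on the sample \<open>(\<tau>, m, e)\<close>, so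
  \<open>integral_PiM_resample\<close> replaces that sample by an independent one.\<close>

lemma integral_fresh_sample:
  fixes \<phi> :: "'a \<Rightarrow> 's \<Rightarrow> real"
  assumes \<tau>: "\<tau> < num_rounds P" and m: "m \<in> clients" and e: "e < num_epochs P"
    and \<phi>: "(\<lambda>(\<theta>, \<xi>). \<phi> \<theta> \<xi>) \<in> borel_measurable (borel \<Otimes>\<^sub>M data_distr P i m)"
    and bounded: "\<And>\<theta> \<xi>. \<xi> \<in> space (data_distr P i m) \<Longrightarrow> \<bar>\<phi> \<theta> \<xi>\<bar> \<le> C"
  shows "(\<integral>\<kappa>. (if m \<in> fst \<kappa> \<tau> then \<phi> (local_iterate \<kappa> \<tau> m e) (snd \<kappa> (\<tau>, m, e)) else 0) \<partial>\<Omega>)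
    = (\<integral>\<kappa>. (if m \<in> fst \<kappa> \<tau> then \<integral>\<xi>. \<phi> (local_iterate \<kappa> \<tau> m e) \<xi> \<partial>data_distr P i m else 0) \<partial>\<Omega>)"
    (is "?lhs = ?rhs")
proof -
  let ?D = "data_distr P i m"
  interpret C: prob_space client_sets_measure by (rule prob_space_client_sets)
  interpret S: prob_space samples_measure by (rule prob_space_samples)
  interpret D: prob_space ?D by (rule prob_data[OF m])
  interpret O: pair_prob_space client_sets_measure samples_measure ..
  \<comment> \<open>The sign of \<open>C\<close> is needed where \<open>m\<close> is not selected
    and the integrand is zero.\<close>
  obtain \<xi>\<^sub>0 where "\<xi>\<^sub>0 \<in> space ?D"
    using D.not_empty by blast
  then have C: "0 \<le> C"
    using bounded[of \<xi>\<^sub>0 \<theta>'] by linarith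
  define f where "f \<kappa> \<xi> = (if m \<in> fst \<kappa> \<tau> then \<phi> (local_iterate \<kappa> \<tau> m e) \<xi> else 0)" for \<kappa> \<xi>
  have f_bound: "\<bar>f \<kappa> \<xi>\<bar> \<le> C" if "\<xi> \<in> space ?D" for \<kappa> \<xi>
    using bounded[OF that] C by (simp add: f_def)
  have f: "(\<lambda>p. f (fst p) (snd p)) \<in> borel_measurable (\<Omega> \<Otimes>\<^sub>M ?D)"
    unfolding f_def
  proof (rule measurable_If)
    show "(\<lambda>p. \<phi> (local_iterate (fst p) \<tau> m e) (snd p)) \<in> borel_measurable (\<Omega> \<Otimes>\<^sub>M ?D)"
      using measurable_compose[OF measurable_Pair[OF measurable_compose[OF measurable_fst
          measurable_local_iterate[OF \<tau> m less_imp_le[OF e]]] measurable_snd[of \<Omega> ?D]] \<phi>]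
      by simp
    show "{p \<in> space (\<Omega> \<Otimes>\<^sub>M ?D). m \<in> fst (fst p) \<tau>} \<in> sets (\<Omega> \<Otimes>\<^sub>M ?D)"
      using measurable_compose[OF measurable_fst[of \<Omega> ?D] measurable_client_selected[OF \<tau>, of m]]
      by (simp add: pred_def)
  qed simp
  have f_sample: "(\<lambda>\<kappa>. f \<kappa> (snd \<kappa> (\<tau>, m, e))) \<in> borel_measurable \<Omega>"
    using measurable_compose[OF measurable_Pair[OF measurable_ident_sets[OF refl]
      measurable_sample[OF \<tau> m e]] f]
    by simp
  have f_integral: "(\<lambda>\<kappa>. \<integral>\<xi>. f \<kappa> \<xi> \<partial>?D) \<in> borel_measurable \<Omega>"
    using f by (intro D.borel_measurable_lebesgue_integral) (simp add: case_prod_beta')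
  have norm_integral: "\<bar>\<integral>\<xi>. f \<kappa> \<xi> \<partial>?D\<bar> \<le> C" for \<kappa>
  proof -
    have "\<bar>\<integral>\<xi>. f \<kappa> \<xi> \<partial>?D\<bar> \<le> (\<integral>\<xi>. \<bar>f \<kappa> \<xi>\<bar> \<partial>?D)"
      using integral_norm_bound[of ?D "f \<kappa>"] by simp
    also have "\<dots> \<le> (\<integral>\<xi>. C \<partial>?D)"
      using f_bound C by (intro integral_mono') auto
    also have "\<dots> = C"
      by (simp add: D.prob_space)
    finally show ?thesis .
  qed
  have "?lhs = (\<integral>\<kappa>. f \<kappa> (snd \<kappa> (\<tau>, m, e)) \<partial>\<Omega>)"
    by (simp add: f_def)
  \<comment> \<open>Fubini puts the client sets outside, so that resampling takes place in the
    product of the samples alone.\<close>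
  also have "\<dots> = (\<integral>s. \<integral>X. f (s, X) (X (\<tau>, m, e)) \<partial>samples_measure \<partial>client_sets_measure)"
    unfolding draws_measure_eq
  proof (subst O.integral_fst'[symmetric])
    show "integrable (client_sets_measure \<Otimes>\<^sub>M samples_measure) (\<lambda>\<kappa>. f \<kappa> (snd \<kappa> (\<tau>, m, e)))"
      using f_sample f_bound space_drawsD(3)[OF _ \<tau> m e]
      by (intro O.integrable_const_bound[where B = C]) (auto simp: draws_measure_eq)
  qed simp
  also have "\<dots> = (\<integral>s. \<integral>X. \<integral>\<xi>. f (s, X) \<xi> \<partial>?D \<partial>samples_measure \<partial>client_sets_measure)"
  proof (rule Bochner_Integration.integral_cong[OF refl])
    fix s assume s: "s \<in> space client_sets_measure"
    let ?J = "{..<num_rounds P} \<times> clients \<times> {..<num_epochs P}"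
    let ?M = "\<lambda>(t, m, e). data_distr P i m"
    have *: "(\<lambda>p. f (s, fst p) (snd p)) \<in> borel_measurable (samples_measure \<Otimes>\<^sub>M ?D)"
      using measurable_compose[OF _ f, of "\<lambda>p. ((s, fst p), snd p)" "samples_measure \<Otimes>\<^sub>M ?D"] s
      by (simp add: draws_measure_eq)
    have "(\<integral>X. f (s, X) (X (\<tau>, m, e)) \<partial>PiM ?J ?M) =
        (\<integral>X. \<integral>\<xi>. f (s, X) \<xi> \<partial>?M (\<tau>, m, e) \<partial>PiM ?J ?M)"
    proof (rule integral_PiM_resample)
      show "(\<lambda>(X, \<xi>). f (s, X) \<xi>) \<in> borel_measurable (PiM ?J ?M \<Otimes>\<^sub>M ?M (\<tau>, m, e))"
        using * by (simp add: samples_measure_def case_prod_beta')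
      show "\<bar>f (s, X) \<xi>\<bar> \<le> C" if "\<xi> \<in> space (?M (\<tau>, m, e))" for X \<xi>
        using that f_bound by simp
      show "f (s, X((\<tau>, m, e) := \<xi>')) \<xi> = f (s, X) \<xi>" for X \<xi> \<xi>'
        by (simp add: f_def local_iterate_update)
    qed (use \<tau> m e prob_data in auto)
    then show "(\<integral>X. f (s, X) (X (\<tau>, m, e)) \<partial>samples_measure) =
        (\<integral>X. \<integral>\<xi>. f (s, X) \<xi> \<partial>?D \<partial>samples_measure)"
      by (simp add: samples_measure_def)
  qed
  also have "\<dots> = (\<integral>\<kappa>. \<integral>\<xi>. f \<kappa> \<xi> \<partial>?D \<partial>\<Omega>)"
    unfolding draws_measure_eq
  proof (rule O.integral_fst')
    show "integrable (client_sets_measure \<Otimes>\<^sub>M samples_measure) (\<lambda>\<kappa>. \<integral>\<xi>. f \<kappa> \<xi> \<partial>?D)"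
      using f_integral norm_integral
      by (intro O.integrable_const_bound[where B = C]) (auto simp: draws_measure_eq)
  qed
  also have "\<dots> = ?rhs"
    by (intro Bochner_Integration.integral_cong) (auto simp: f_def)
  finally show ?thesis .
qed

text \<open>By unbiasedness the second moment is the variance plus the squared norm of the true
  gradient \<open>G\<close>. The latter contributes at most \<open>c * B * norm G\<close>, hence at
  most \<open>\<epsilon> * norm u * norm G\<close>, which the alignment cancels against the linear
  term.\<close>

lemma integral_step_le:
  assumes m: "m \<in> clients" and c: "0 \<le> c" "c * B \<le> \<epsilon> * norm u"
    and unbiased: "unbiased_at P i m \<theta>"
    and variance: "variance_bounded_at P \<sigma> i m \<theta>"
    and alignment: "\<epsilon> * norm u * norm (grad (local_loss P i m) \<theta>) \<le> u \<bullet> grad (local_loss P i m) \<theta>"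
  shows "(\<integral>\<xi>. c * (norm (stoch_grad P i m \<theta> \<xi>))\<^sup>2 - u \<bullet> stoch_grad P i m \<theta> \<xi> \<partial>data_distr P i m)
    \<le> c * \<sigma>\<^sup>2"
proof -
  let ?D = "data_distr P i m" and ?g = "stoch_grad P i m \<theta>" and ?G = "grad (local_loss P i m) \<theta>"
  interpret prob_space ?D by (rule prob_data[OF m])
  have [measurable]: "?g \<in> borel_measurable ?D"
    by (rule measurable_stoch_grad_compose[OF m, of "\<lambda>_. \<theta>" ?D "\<lambda>\<xi>. \<xi>"]) auto
  have g_bound: "norm (?g \<xi>) \<le> B" if "\<xi> \<in> space ?D" for \<xi>
    using stoch_grad_bound[OF m that] .
  have int_g: "integrable ?D ?g"
    by (rule integrable_const_bound[where B = B]) (auto intro: g_bound)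
  have int_sq: "integrable ?D (\<lambda>\<xi>. (norm (?g \<xi> - a))\<^sup>2)" for a
  proof (rule integrable_const_bound[where B = "(B + norm a)\<^sup>2"])
    show "AE \<xi> in ?D. norm ((norm (?g \<xi> - a))\<^sup>2) \<le> (B + norm a)\<^sup>2"
    proof (rule AE_I2)
      fix \<xi> assume "\<xi> \<in> space ?D"
      then have "norm (?g \<xi> - a) \<le> B + norm a"
        using g_bound[of \<xi>] norm_triangle_ineq4[of "?g \<xi>" a] by linarith
      then show "norm ((norm (?g \<xi> - a))\<^sup>2) \<le> (B + norm a)\<^sup>2"
        by (simp add: power_mono)
    qed
  qed simp
  have G: "(\<integral>\<xi>. ?g \<xi> \<partial>?D) = ?G"
    using unbiased by (simp add: unbiased_at_def)
  \<comment> \<open>The bound \<open>B\<close> passes from the stochastic gradients to their mean,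
    which is the true gradient.\<close>
  have "norm ?G \<le> (\<integral>\<xi>. norm (?g \<xi>) \<partial>?D)"
    unfolding G[symmetric] by (rule integral_norm_bound)
  also have "\<dots> \<le> B"
    by (intro integral_le_const integrable_norm int_g AE_I2 g_bound)
  finally have G_bound: "norm ?G \<le> B" .
  \<comment> \<open>The square is expanded around the mean; after integration the cross term is
    twice the squared norm of the mean, so one copy remains.\<close>
  have "c * (norm (?g \<xi>))\<^sup>2 - u \<bullet> ?g \<xi> =
      c * (norm (?g \<xi> - ?G))\<^sup>2 + (2 * c) * (?g \<xi> \<bullet> ?G) - c * (norm ?G)\<^sup>2 - ?g \<xi> \<bullet> u" for \<xi>
    by (simp add: power2_norm_eq_inner inner_diff_left inner_diff_right inner_commute algebra_simps)
  then have "(\<integral>\<xi>. c * (norm (?g \<xi>))\<^sup>2 - u \<bullet> ?g \<xi> \<partial>?D) =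
      c * (\<integral>\<xi>. (norm (?g \<xi> - ?G))\<^sup>2 \<partial>?D) + (2 * c) * (?G \<bullet> ?G) - c * (norm ?G)\<^sup>2 - ?G \<bullet> u"
    using int_g int_sq[of ?G] by (simp add: G prob_space)
  also have "\<dots> = c * (\<integral>\<xi>. (norm (?g \<xi> - ?G))\<^sup>2 \<partial>?D) + c * (norm ?G)\<^sup>2 - u \<bullet> ?G"
    by (simp add: power2_norm_eq_inner inner_commute)
  also have "\<dots> \<le> c * \<sigma>\<^sup>2 + c * (norm ?G)\<^sup>2 - u \<bullet> ?G"
    using variance c by (intro diff_right_mono add_right_mono mult_left_mono)
      (auto simp: variance_bounded_at_def)
  also have "\<dots> \<le> c * \<sigma>\<^sup>2"
  proof -
    have "c * (norm ?G)\<^sup>2 \<le> (c * B) * norm ?G"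
      using G_bound c by (simp add: power2_eq_square mult_left_mono mult_right_mono mult.assoc)
    also have "\<dots> \<le> \<epsilon> * norm u * norm ?G"
      using c by (intro mult_right_mono) auto
    finally show ?thesis
      using alignment by linarith
  qed
  finally show ?thesis .
qed

text \<open>Supplies the constant for the integrability arguments and for
  \<open>integral_fresh_sample\<close>.\<close>

lemma bounded_step_term:
  assumes "m \<in> clients" "0 \<le> c" "\<xi> \<in> space (data_distr P i m)"
  shows "\<bar>c * (norm (stoch_grad P i m \<theta> \<xi>))\<^sup>2 - u \<bullet> stoch_grad P i m \<theta> \<xi>\<bar> \<le> c * B\<^sup>2 + norm u * B"
proof -
  let ?g = "stoch_grad P i m \<theta> \<xi>"
  have g: "norm ?g \<le> B"
    using stoch_grad_bound assms by blast
  have "\<bar>c * (norm ?g)\<^sup>2 - u \<bullet> ?g\<bar> \<le> c * (norm ?g)\<^sup>2 + norm u * norm ?g"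
    using Cauchy_Schwarz_ineq2[of u ?g] assms(2) by (simp add: abs_le_iff) (smt (verit) mult_nonneg_nonneg zero_le_power2)
  also have "\<dots> \<le> c * B\<^sup>2 + norm u * B"
    using g assms(2) by (intro add_mono mult_left_mono power_mono) auto
  finally show ?thesis .
qed

text \<open>After the sample is replaced by an independent one, \<open>integral_step_le\<close>
  applies at almost every iterate. The indicator stays on both sides so that the selection weights
  can later be summed exactly.\<close>

lemma integral_selected_step_le:
  assumes \<tau>: "\<tau> < num_rounds P" and m: "m \<in> clients" and e: "e < num_epochs P"
    and c: "0 \<le> c" "c * B \<le> \<epsilon> * norm u"
    and unbiased: "AE \<kappa> in \<Omega>. unbiased_at P i m (local_iterate \<kappa> \<tau> m e)"
    and variance: "AE \<kappa> in \<Omega>. variance_bounded_at P \<sigma> i m (local_iterate \<kappa> \<tau> m e)"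
    and alignment: "AE \<kappa> in \<Omega>. \<epsilon> * norm u * norm (grad (local_loss P i m) (local_iterate \<kappa> \<tau> m e))
      \<le> u \<bullet> grad (local_loss P i m) (local_iterate \<kappa> \<tau> m e)"
  shows "(\<integral>\<kappa>. (if m \<in> fst \<kappa> \<tau> then c * (norm (step_grad \<kappa> \<tau> m e))\<^sup>2 - u \<bullet> step_grad \<kappa> \<tau> m e else 0) \<partial>\<Omega>)
    \<le> (\<integral>\<kappa>. (if m \<in> fst \<kappa> \<tau> then c * \<sigma>\<^sup>2 else 0) \<partial>\<Omega>)"
proof -
  let ?D = "data_distr P i m"
  define \<phi> where "\<phi> \<theta> \<xi> = c * (norm (stoch_grad P i m \<theta> \<xi>))\<^sup>2 - u \<bullet> stoch_grad P i m \<theta> \<xi>" for \<theta> \<xi>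
  interpret prob_space \<Omega> by (rule prob_space_draws)
  interpret D: prob_space ?D by (rule prob_data[OF m])
  note [measurable] = measurable_stoch_grad[OF m] measurable_client_selected[OF \<tau>]
  have \<phi>: "(\<lambda>(\<theta>, \<xi>). \<phi> \<theta> \<xi>) \<in> borel_measurable (borel \<Otimes>\<^sub>M ?D)"
    unfolding \<phi>_def by measurable
  have \<phi>_bound: "\<bar>\<phi> \<theta> \<xi>\<bar> \<le> c * B\<^sup>2 + norm u * B" if "\<xi> \<in> space ?D" for \<theta> \<xi>
    unfolding \<phi>_def using that m c by (intro bounded_step_term) auto
  have int_const: "integrable \<Omega> (\<lambda>\<kappa>. if m \<in> fst \<kappa> \<tau> then c * \<sigma>\<^sup>2 else 0)"
    using c by (intro integrable_const_bound[where B = "c * \<sigma>\<^sup>2"]) auto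
  have "(\<integral>\<kappa>. (if m \<in> fst \<kappa> \<tau> then \<integral>\<xi>. \<phi> (local_iterate \<kappa> \<tau> m e) \<xi> \<partial>?D else 0) \<partial>\<Omega>)
      \<le> (\<integral>\<kappa>. (if m \<in> fst \<kappa> \<tau> then c * \<sigma>\<^sup>2 else 0) \<partial>\<Omega>)"
  \<comment> \<open>The larger side is nonnegative because \<open>c\<close> is, so its integrability
    suffices for the comparison.\<close>
  proof (rule integral_mono_AE'[OF int_const])
    show "AE \<kappa> in \<Omega>. (if m \<in> fst \<kappa> \<tau> then \<integral>\<xi>. \<phi> (local_iterate \<kappa> \<tau> m e) \<xi> \<partial>?D else 0)
        \<le> (if m \<in> fst \<kappa> \<tau> then c * \<sigma>\<^sup>2 else 0)"
      using unbiased variance alignment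
    proof eventually_elim
      case (elim \<kappa>)
      then show ?case
        using integral_step_le[OF m c elim] by (simp add: \<phi>_def[abs_def])
    qed
  qed (use c in auto)
  then show ?thesis
    using integral_fresh_sample[OF \<tau> m e \<phi> \<phi>_bound] unfolding \<phi>_def step_grad_def by simp
qed

subsection \<open>Descent over several rounds\<close>

text \<open>Each round scales the displacement from \<open>\<theta>'\<close> by
  \<open>1 / (1 + prox_weight P)\<close>. The pull-back also acts on the round's own update, so
  round \<open>\<tau>\<close> is damped \<open>t - \<tau>\<close> times, which is at least
  once.\<close>

lemma task_model_eq_sum:
  "task_model P i \<kappa> \<theta>' t - \<theta>' = - (global_lr P * local_lr P) *\<^sub>R
    (\<Sum>\<tau><t. ((1 / (1 + prox_weight P)) ^ (t - \<tau>) / num_participants P) *\<^sub>R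
      (\<Sum>m\<in>fst \<kappa> \<tau>. \<Sum>e<num_epochs P. step_grad \<kappa> \<tau> m e))"
  if prox: "prox_weight P > 0"
proof (induction t)
  case (Suc t)
  let ?q = "1 / (1 + prox_weight P)" and ?\<gamma> = "global_lr P * local_lr P"
  let ?x = "\<lambda>\<tau>. \<Sum>m\<in>fst \<kappa> \<tau>. \<Sum>e<num_epochs P. step_grad \<kappa> \<tau> m e"
  let ?\<theta> = "task_model P i \<kappa> \<theta>' t"
  have "(\<Sum>m\<in>fst \<kappa> t. local_sgd P i m (\<lambda>e. snd \<kappa> (t, m, e)) ?\<theta> (num_epochs P) - ?\<theta>) =
      - local_lr P *\<^sub>R ?x t"
    by (simp add: local_sgd_eq_sum step_grad_def local_iterate_def scaleR_sum_right sum_negf)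
  then have "task_model P i \<kappa> \<theta>' (Suc t) =
      ?q *\<^sub>R (?\<theta> - (?\<gamma> / num_participants P) *\<^sub>R ?x t) + (prox_weight P * ?q) *\<^sub>R \<theta>'"
    by (simp add: Let_def)
  \<comment> \<open>The two averaging coefficients sum to one, so averaging with
    \<open>\<theta>'\<close> contracts towards it.\<close>
  moreover have "(prox_weight P * ?q) *\<^sub>R \<theta>' = \<theta>' - ?q *\<^sub>R \<theta>'"
  proof -
    have "prox_weight P * ?q = 1 - ?q"
      using prox by (simp add: field_simps)
    then show ?thesis
      by (simp add: scaleR_left_diff_distrib)
  qed
  ultimately have "task_model P i \<kappa> \<theta>' (Suc t) - \<theta>' =
      ?q *\<^sub>R (?\<theta> - \<theta>') - (?q * ?\<gamma> / num_participants P) *\<^sub>R ?x t"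
    by (simp add: scaleR_right_diff_distrib)
  also have "\<dots> = - ?\<gamma> *\<^sub>R ((\<Sum>\<tau><t. (?q ^ (Suc t - \<tau>) / num_participants P) *\<^sub>R ?x \<tau>)
      + (?q / num_participants P) *\<^sub>R ?x t)"
    unfolding Suc
    by (simp add: scaleR_right_distrib scaleR_sum_right Suc_diff_le mult_ac sum_negf)
  finally show ?case
    by simp
qed simp

text \<open>The random selection is moved into the weight, which vanishes for non-selected clients,
  so that sums run over the fixed set \<open>steps t\<close> and commute with the
  expectation.\<close>

definition step_weight :: "nat \<Rightarrow> 's draws \<Rightarrow> nat \<times> nat \<times> nat \<Rightarrow> real" where
  "step_weight t \<kappa> = (\<lambda>(\<tau>, m, e). (if m \<in> fst \<kappa> \<tau>
     then (1 / (1 + prox_weight P)) ^ (t - \<tau>) / num_participants P else 0))"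

text \<open>The quantity \<open>A\<close> of the introduction: a geometric sum with exponents
  \<open>1\<close> to \<open>t\<close>.\<close>

definition decay_sum :: "nat \<Rightarrow> real" where
  "decay_sum t = (\<Sum>\<tau><t. (1 / (1 + prox_weight P)) ^ (t - \<tau>))"

abbreviation "steps t \<equiv> {..<t} \<times> clients \<times> {..<num_epochs P}"

lemma step_weight_nonneg: "prox_weight P > 0 \<Longrightarrow> 0 \<le> step_weight t \<kappa> j"
  by (auto simp: step_weight_def split: prod.split)

text \<open>Kept general in the vector space: the stochastic gradients give the displacement, and
  the constant \<open>1\<close> gives the total weight.\<close>

lemma sum_step_weight_scaleR:
  fixes g :: "nat \<Rightarrow> nat \<Rightarrow> nat \<Rightarrow> 'b::real_vector"
  assumes "\<kappa> \<in> space \<Omega>" "t \<le> num_rounds P"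
  shows "(\<Sum>(\<tau>, m, e)\<in>steps t. step_weight t \<kappa> (\<tau>, m, e) *\<^sub>R g \<tau> m e) =
    (\<Sum>\<tau><t. ((1 / (1 + prox_weight P)) ^ (t - \<tau>) / num_participants P) *\<^sub>R
      (\<Sum>m\<in>fst \<kappa> \<tau>. \<Sum>e<num_epochs P. g \<tau> m e))"
proof -
  let ?w = "\<lambda>\<tau>. (1 / (1 + prox_weight P)) ^ (t - \<tau>) / num_participants P"
  have "(\<Sum>(\<tau>, m, e)\<in>steps t. step_weight t \<kappa> (\<tau>, m, e) *\<^sub>R g \<tau> m e) =
      (\<Sum>\<tau><t. \<Sum>m\<in>clients. \<Sum>e<num_epochs P. step_weight t \<kappa> (\<tau>, m, e) *\<^sub>R g \<tau> m e)"
    by (simp add: sum.cartesian_product)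
  also have "\<dots> = (\<Sum>\<tau><t. \<Sum>m\<in>clients. if m \<in> fst \<kappa> \<tau> then ?w \<tau> *\<^sub>R (\<Sum>e<num_epochs P. g \<tau> m e) else 0)"
    by (intro sum.cong refl) (auto simp: step_weight_def scaleR_sum_right)
  also have "\<dots> = (\<Sum>\<tau><t. \<Sum>m\<in>fst \<kappa> \<tau>. ?w \<tau> *\<^sub>R (\<Sum>e<num_epochs P. g \<tau> m e))"
  proof (rule sum.cong[OF refl])
    fix \<tau> assume "\<tau> \<in> {..<t}"
    then have "fst \<kappa> \<tau> \<subseteq> clients"
      using space_drawsD(1) assms by auto
    then show "(\<Sum>m\<in>clients. if m \<in> fst \<kappa> \<tau> then ?w \<tau> *\<^sub>R (\<Sum>e<num_epochs P. g \<tau> m e) else 0) =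
        (\<Sum>m\<in>fst \<kappa> \<tau>. ?w \<tau> *\<^sub>R (\<Sum>e<num_epochs P. g \<tau> m e))"
      by (subst sum.inter_restrict[symmetric]) (auto simp: Int_absorb1)
  qed
  finally show ?thesis
    by (simp add: scaleR_sum_right)
qed

text \<open>Every client set has exactly \<open>num_participants P\<close> elements, which cancels
  the averaging factor. The total weight is therefore not random.\<close>

lemma sum_step_weight:
  assumes "\<kappa> \<in> space \<Omega>" "t \<le> num_rounds P"
  shows "(\<Sum>j\<in>steps t. step_weight t \<kappa> j) = decay_sum t * num_epochs P"
proof -
  have "(\<Sum>j\<in>steps t. step_weight t \<kappa> j) =
      (\<Sum>\<tau><t. ((1 / (1 + prox_weight P)) ^ (t - \<tau>) / num_participants P) *
        (card (fst \<kappa> \<tau>) * num_epochs P))"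
    using sum_step_weight_scaleR[OF assms, of "\<lambda>_ _ _. 1::real"] by (simp add: case_prod_beta')
  also have "\<dots> = (\<Sum>\<tau><t. (1 / (1 + prox_weight P)) ^ (t - \<tau>) * num_epochs P)"
    using assms participants space_drawsD(2) by (intro sum.cong) auto
  finally show ?thesis
    by (simp add: decay_sum_def sum_distrib_right)
qed

lemma task_model_eq_weighted_sum:
  assumes "\<kappa> \<in> space \<Omega>" "t \<le> num_rounds P" "prox_weight P > 0"
  shows "task_model P i \<kappa> \<theta>' t - \<theta>' = - (global_lr P * local_lr P) *\<^sub>R
    (\<Sum>(\<tau>, m, e)\<in>steps t. step_weight t \<kappa> (\<tau>, m, e) *\<^sub>R step_grad \<kappa> \<tau> m e)"
  by (simp only: task_model_eq_sum[OF assms(3)] sum_step_weight_scaleR[OF assms(1,2)])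

text \<open>Confines the model to a deterministic ball, on which a continuous loss is bounded and
  hence integrable.\<close>

lemma norm_task_model_le:
  assumes "\<kappa> \<in> space \<Omega>" "t \<le> num_rounds P" "prox_weight P > 0"
  shows "norm (task_model P i \<kappa> \<theta>' t - \<theta>') \<le>
    \<bar>global_lr P * local_lr P\<bar> * (decay_sum t * num_epochs P * B)"
proof -
  have "norm (\<Sum>(\<tau>, m, e)\<in>steps t. step_weight t \<kappa> (\<tau>, m, e) *\<^sub>R step_grad \<kappa> \<tau> m e) \<le>
      (\<Sum>j\<in>steps t. step_weight t \<kappa> j * B)"
    using assms step_weight_nonneg[OF assms(3)]
    by (intro order.trans[OF norm_sum] sum_mono)
       (auto simp: abs_of_nonneg[OF step_weight_nonneg[OF assms(3)]]
        intro!: mult_left_mono step_grad_bound step_weight_nonneg)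
  also have "\<dots> = decay_sum t * num_epochs P * B"
    by (simp only: sum_step_weight[OF assms(1,2)] flip: sum_distrib_right)
  finally show ?thesis
    unfolding task_model_eq_weighted_sum[OF assms] norm_scaleR abs_minus_cancel
    by (intro mult_left_mono) auto
qed

text \<open>Smoothness is used once, between \<open>\<theta>'\<close> and the model after
  \<open>t\<close> rounds, so the only old gradient that appears is the one at
  \<open>\<theta>'\<close>. Weighted Cauchy-Schwarz splits the quadratic term over the single steps;
  the total weight it produces goes into \<open>c\<close>.\<close>

lemma descent_bound:
  fixes F :: "'a \<Rightarrow> real"
  assumes F: "\<And>x. GDERIV F x :> F' x"
    and smooth: "\<And>x y. norm (F' x - F' y) \<le> \<Lambda> * norm (x - y)"
    and \<Lambda>: "0 \<le> \<Lambda>" and lr: "0 \<le> \<gamma>" "\<gamma> = global_lr P * local_lr P"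
    and prox: "prox_weight P > 0"
    and \<kappa>: "\<kappa> \<in> space \<Omega>" and t: "t \<le> num_rounds P"
    and c: "c = \<Lambda> / 2 * \<gamma> * (decay_sum t * num_epochs P)"
  shows "F (task_model P i \<kappa> \<theta>' t) \<le> F \<theta>' + \<gamma> * (\<Sum>(\<tau>, m, e)\<in>steps t.
    step_weight t \<kappa> (\<tau>, m, e) * (c * (norm (step_grad \<kappa> \<tau> m e))\<^sup>2 - F' \<theta>' \<bullet> step_grad \<kappa> \<tau> m e))"
proof -
  let ?w = "step_weight t \<kappa>" and ?g = "\<lambda>(\<tau>, m, e). step_grad \<kappa> \<tau> m e" and ?u = "F' \<theta>'"
  let ?S = "\<Sum>j\<in>steps t. ?w j *\<^sub>R ?g j" and ?W = "decay_sum t * num_epochs P"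
  have D: "task_model P i \<kappa> \<theta>' t - \<theta>' = - \<gamma> *\<^sub>R ?S"
    using task_model_eq_weighted_sum[OF \<kappa> t prox] by (simp add: lr case_prod_beta')
  have "(norm ?S)\<^sup>2 \<le> ?W * (\<Sum>j\<in>steps t. ?w j * (norm (?g j))\<^sup>2)"
    using norm_weighted_sum_sq_le[of "steps t" ?w ?g] step_weight_nonneg[OF prox]
    unfolding sum_step_weight[OF \<kappa> t] by simp
  then have "\<Lambda> / 2 * \<gamma>\<^sup>2 * (norm ?S)\<^sup>2 \<le> \<Lambda> / 2 * \<gamma>\<^sup>2 * (?W * (\<Sum>j\<in>steps t. ?w j * (norm (?g j))\<^sup>2))"
    using \<Lambda> by (intro mult_left_mono) auto
  moreover have "F (task_model P i \<kappa> \<theta>' t) \<le> F \<theta>' - \<gamma> * (?u \<bullet> ?S) + \<Lambda> / 2 * \<gamma>\<^sup>2 * (norm ?S)\<^sup>2"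
    using smooth_upper_bound[OF F smooth, of "task_model P i \<kappa> \<theta>' t" \<theta>']
    unfolding D by (simp add: power_mult_distrib)
  ultimately have "F (task_model P i \<kappa> \<theta>' t) \<le> F \<theta>' - \<gamma> * (?u \<bullet> ?S)
      + \<Lambda> / 2 * \<gamma>\<^sup>2 * (?W * (\<Sum>j\<in>steps t. ?w j * (norm (?g j))\<^sup>2))"
    by linarith
  also have "\<dots> = F \<theta>' + \<gamma> * (c * (\<Sum>j\<in>steps t. ?w j * (norm (?g j))\<^sup>2) - ?u \<bullet> ?S)"
    by (simp add: c algebra_simps power2_eq_square)
  also have "c * (\<Sum>j\<in>steps t. ?w j * (norm (?g j))\<^sup>2) - ?u \<bullet> ?S =
      (\<Sum>j\<in>steps t. ?w j * (c * (norm (?g j))\<^sup>2 - ?u \<bullet> ?g j))"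
    by (simp add: inner_sum_right sum_distrib_left sum_subtractf[symmetric] algebra_simps)
  finally show ?thesis
    by (simp add: case_prod_beta')
qed

section \<open>Expectation of the loss after several rounds\<close>

lemma integrable_task_model:
  fixes F :: "'a \<Rightarrow> real"
  assumes F: "continuous_on UNIV F" and t: "t \<le> num_rounds P" and prox: "prox_weight P > 0"
  shows "integrable \<Omega> (\<lambda>\<kappa>. F (task_model P i \<kappa> \<theta>' t))"
proof -
  interpret prob_space \<Omega> by (rule prob_space_draws)
  let ?r = "\<bar>global_lr P * local_lr P\<bar> * (decay_sum t * num_epochs P * B)"
  have "compact (F ` cball \<theta>' ?r)"
    using continuous_on_subset[OF F] by (intro compact_continuous_image) auto
  then obtain C where "\<forall>y\<in>F ` cball \<theta>' ?r. norm y \<le> C"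
    using compact_imp_bounded bounded_iff by blast
  then have C: "norm (F x) \<le> C" if "x \<in> cball \<theta>' ?r" for x
    using that by blast
  show ?thesis
  proof (rule integrable_const_bound[where B = C])
    show "AE \<kappa> in \<Omega>. norm (F (task_model P i \<kappa> \<theta>' t)) \<le> C"
      using norm_task_model_le[OF _ t prox] by (intro AE_I2 C) (auto simp: dist_norm norm_minus_commute)
    show "(\<lambda>\<kappa>. F (task_model P i \<kappa> \<theta>' t)) \<in> borel_measurable \<Omega>"
      using measurable_compose[OF measurable_task_model[OF t] borel_measurable_continuous_onI[OF F]] .
  qed
qed

text \<open>Integrates the pathwise descent bound step by step. Each step leaves only
  \<open>c * \<sigma>\<^sup>2\<close> where its client is selected, and these contributions are
  added up with the deterministic total weight.\<close>

lemma expected_loss_le: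
  fixes F :: "'a \<Rightarrow> real"
  assumes F: "\<And>x. GDERIV F x :> F' x"
    and smooth: "\<And>x y. norm (F' x - F' y) \<le> \<Lambda> * norm (x - y)"
    and \<Lambda>: "0 \<le> \<Lambda>" and lr: "0 \<le> \<gamma>" "\<gamma> = global_lr P * local_lr P"
    and prox: "prox_weight P > 0" and t: "t \<le> num_rounds P"
    and c: "c = \<Lambda> / 2 * \<gamma> * (decay_sum t * num_epochs P)" "c * B \<le> \<epsilon> * norm (F' \<theta>')"
    and unbiased: "\<And>\<tau> m e. \<tau> < t \<Longrightarrow> m \<in> clients \<Longrightarrow> e < num_epochs P \<Longrightarrow>
      AE \<kappa> in \<Omega>. unbiased_at P i m (local_iterate \<kappa> \<tau> m e)"
    and variance: "\<And>\<tau> m e. \<tau> < t \<Longrightarrow> m \<in> clients \<Longrightarrow> e < num_epochs P \<Longrightarrow>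
      AE \<kappa> in \<Omega>. variance_bounded_at P \<sigma> i m (local_iterate \<kappa> \<tau> m e)"
    and alignment: "\<And>\<tau> m e. \<tau> < t \<Longrightarrow> m \<in> clients \<Longrightarrow> e < num_epochs P \<Longrightarrow>
      AE \<kappa> in \<Omega>. \<epsilon> * norm (F' \<theta>') * norm (grad (local_loss P i m) (local_iterate \<kappa> \<tau> m e))
        \<le> F' \<theta>' \<bullet> grad (local_loss P i m) (local_iterate \<kappa> \<tau> m e)"
  shows "(\<integral>\<kappa>. F (task_model P i \<kappa> \<theta>' t) \<partial>\<Omega>) \<le> F \<theta>' + \<gamma> * (c * \<sigma>\<^sup>2 * (decay_sum t * num_epochs P))"
proof -
  interpret prob_space \<Omega> by (rule prob_space_draws)
  \<comment> \<open>The step weight is split into the deterministic factor \<open>v\<close> and the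
    selection indicator, which goes into the step term \<open>h\<close> and its noise bound
    \<open>b\<close>; thus \<open>v\<close> leaves the integral.\<close>
  define v where "v \<tau> = (1 / (1 + prox_weight P)) ^ (t - \<tau>) / num_participants P" for \<tau>
  define h where "h \<kappa> = (\<lambda>(\<tau>, m, e). if m \<in> fst \<kappa> \<tau>
    then c * (norm (step_grad \<kappa> \<tau> m e))\<^sup>2 - F' \<theta>' \<bullet> step_grad \<kappa> \<tau> m e else 0)" for \<kappa>
  define b where "b \<kappa> = (\<lambda>(\<tau> :: nat, m, e :: nat). if m \<in> fst \<kappa> \<tau> then c * \<sigma>\<^sup>2 else 0)" for \<kappa> :: "'s draws"
  have c0: "0 \<le> c"
    using \<Lambda> lr prox by (auto simp: c decay_sum_def intro!: mult_nonneg_nonneg sum_nonneg)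
  have v0: "0 \<le> v \<tau>" for \<tau>
    using prox by (simp add: v_def)
  have cont: "continuous_on UNIV F"
    using F by (auto simp: gderiv_def continuous_on_eq_continuous_within intro: has_derivative_continuous)
  have int_h: "integrable \<Omega> (\<lambda>\<kappa>. h \<kappa> j)" if "j \<in> steps t" for j
  proof -
    obtain \<tau> m e where j: "j = (\<tau>, m, e)"
      by (cases j)
    with that t have *: "\<tau> < num_rounds P" "m \<in> clients" "e < num_epochs P"
      by auto
    note [measurable] = measurable_step_grad[OF *] measurable_client_selected[OF *(1)]
    \<comment> \<open>The bound dominates an absolute value at some outcome, so it is nonnegative
      and also covers the outcomes that do not select \<open>m\<close>.\<close>
    have "0 \<le> c * B\<^sup>2 + norm (F' \<theta>') * B"
      using bounded_step_term[OF *(2) c0 space_drawsD(3)[OF _ *]] not_empty abs_ge_zero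
      by (meson ex_in_conv order.trans)
    then show ?thesis
      using bounded_step_term[OF *(2) c0 space_drawsD(3)[OF _ *], of _ _ "F' \<theta>'"]
      unfolding h_def j prod.case
      by (intro integrable_const_bound[where B = "c * B\<^sup>2 + norm (F' \<theta>') * B"] AE_I2)
         (auto simp: step_grad_def)
  qed
  have int_b: "integrable \<Omega> (\<lambda>\<kappa>. b \<kappa> j)" if "j \<in> steps t" for j
  proof -
    obtain \<tau> m e where j: "j = (\<tau>, m, e)"
      by (cases j)
    with that t have [measurable]: "\<tau> < num_rounds P"
      by auto
    show ?thesis
      unfolding b_def j prod.case using c0
      by (intro integrable_const_bound[where B = "c * \<sigma>\<^sup>2"]) auto
  qed
  have "(\<integral>\<kappa>. F (task_model P i \<kappa> \<theta>' t) \<partial>\<Omega>) \<le> (\<integral>\<kappa>. F \<theta>' + \<gamma> * (\<Sum>j\<in>steps t. v (fst j) * h \<kappa> j) \<partial>\<Omega>)"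
  proof (rule integral_mono)
    show "integrable \<Omega> (\<lambda>\<kappa>. F \<theta>' + \<gamma> * (\<Sum>j\<in>steps t. v (fst j) * h \<kappa> j))"
      using int_h by auto
    fix \<kappa> assume \<kappa>: "\<kappa> \<in> space \<Omega>"
    have "(\<Sum>(\<tau>, m, e)\<in>steps t. step_weight t \<kappa> (\<tau>, m, e) *
          (c * (norm (step_grad \<kappa> \<tau> m e))\<^sup>2 - F' \<theta>' \<bullet> step_grad \<kappa> \<tau> m e)) =
        (\<Sum>j\<in>steps t. v (fst j) * h \<kappa> j)"
      by (intro sum.cong) (auto simp: h_def v_def step_weight_def)
    then show "F (task_model P i \<kappa> \<theta>' t) \<le> F \<theta>' + \<gamma> * (\<Sum>j\<in>steps t. v (fst j) * h \<kappa> j)"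
      using descent_bound[OF F smooth \<Lambda> lr prox \<kappa> t c(1)] by simp
  qed (rule integrable_task_model[OF cont t prox])
  also have "\<dots> = F \<theta>' + \<gamma> * (\<Sum>j\<in>steps t. v (fst j) * (\<integral>\<kappa>. h \<kappa> j \<partial>\<Omega>))"
    using int_h by (simp add: prob_space)
  also have "\<dots> \<le> F \<theta>' + \<gamma> * (\<Sum>j\<in>steps t. v (fst j) * (\<integral>\<kappa>. b \<kappa> j \<partial>\<Omega>))"
  proof (intro add_left_mono mult_left_mono sum_mono lr v0)
    fix j assume "j \<in> steps t"
    then show "(\<integral>\<kappa>. h \<kappa> j \<partial>\<Omega>) \<le> (\<integral>\<kappa>. b \<kappa> j \<partial>\<Omega>)"
      using t integral_selected_step_le[OF _ _ _ c0 c(2) unbiased variance alignment]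
      by (auto simp: h_def b_def)
  qed
  also have "\<dots> = F \<theta>' + \<gamma> * (\<integral>\<kappa>. (\<Sum>j\<in>steps t. v (fst j) * b \<kappa> j) \<partial>\<Omega>)"
    using int_b by simp
  \<comment> \<open>The weighted indicators are recombined before integrating, since only their sum
    is constant in \<open>\<kappa>\<close>.\<close>
  also have "(\<integral>\<kappa>. (\<Sum>j\<in>steps t. v (fst j) * b \<kappa> j) \<partial>\<Omega>) =
      (\<integral>\<kappa>. c * \<sigma>\<^sup>2 * (decay_sum t * num_epochs P) \<partial>\<Omega>)"
  proof (rule Bochner_Integration.integral_cong[OF refl])
    fix \<kappa> assume \<kappa>: "\<kappa> \<in> space \<Omega>"
    have "(\<Sum>j\<in>steps t. v (fst j) * b \<kappa> j) = (\<Sum>j\<in>steps t. c * \<sigma>\<^sup>2 * step_weight t \<kappa> j)"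
      by (intro sum.cong) (auto simp: b_def v_def step_weight_def)
    then show "(\<Sum>j\<in>steps t. v (fst j) * b \<kappa> j) = c * \<sigma>\<^sup>2 * (decay_sum t * num_epochs P)"
      by (simp only: sum_step_weight[OF \<kappa> t] flip: sum_distrib_left)
  qed
  finally show ?thesis
    by (simp add: prob_space)
qed

text \<open>Cauchy-Schwarz against the constant \<open>1\<close> yields the factor \<open>t\<close>.
  With \<open>q = 1 / (1 + prox_weight P)\<close>, the remaining geometric sum of ratio
  \<open>q^2\<close> is at most \<open>q^2 / (1 - q^2)\<close>, which is the stated
  fraction.\<close>

lemma decay_sum_bounds:
  assumes "prox_weight P > 0"
  shows "0 \<le> decay_sum t"
    and "(decay_sum t)\<^sup>2 \<le> t * (1 / ((prox_weight P)\<^sup>2 + 2 * prox_weight P))"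
proof -
  let ?q = "1 / (1 + prox_weight P)"
  show "0 \<le> decay_sum t"
    using assms by (auto simp: decay_sum_def intro!: sum_nonneg)
  have q: "0 < ?q\<^sup>2" "?q\<^sup>2 < 1"
    using assms by (auto simp: power_less_one_iff abs_square_less_1)
  have "(decay_sum t)\<^sup>2 \<le> t * (\<Sum>\<tau><t. (?q ^ (t - \<tau>))\<^sup>2)"
    using Cauchy_Schwarz_ineq_sum[of "\<lambda>_. 1" "\<lambda>\<tau>. ?q ^ (t - \<tau>)" "{..<t}"] by (simp add: decay_sum_def)
  \<comment> \<open>Reversing the order of the rounds; the exponents start at one, hence the extra
    factor in front.\<close>
  also have "(\<Sum>\<tau><t. (?q ^ (t - \<tau>))\<^sup>2) = (\<Sum>k<t. ?q\<^sup>2 * (?q\<^sup>2) ^ k)"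
    by (subst sum.nat_diff_reindex[symmetric])
       (intro sum.cong; simp add: power_mult_distrib power_divide power2_eq_square)
  also have "\<dots> \<le> ?q\<^sup>2 / (1 - ?q\<^sup>2)"
    using q by (simp add: sum_gp_strict divide_right_mono mult_left_le flip: sum_distrib_left)
  also have "\<dots> = 1 / ((prox_weight P)\<^sup>2 + 2 * prox_weight P)"
    using assms by (simp add: power_divide divide_simps) (simp add: power2_eq_square algebra_simps)
  finally show "(decay_sum t)\<^sup>2 \<le> t * (1 / ((prox_weight P)\<^sup>2 + 2 * prox_weight P))"
    by (simp add: mult_left_mono)
qed

end

subsection \<open>Learning rates and the cumulative loss\<close>

lemma cumulative_loss_gderiv:
  fixes P :: "('a::euclidean_space, 's) special"
  assumes "\<And>i m. i \<in> {1..k} \<Longrightarrow> m \<in> {1..num_clients P} \<Longrightarrow> local_loss P i m differentiable (at x)"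
  shows "GDERIV (cumulative_loss P k) x :>
    (\<Sum>i=1..k. (1 / num_clients P) *\<^sub>R (\<Sum>m=1..num_clients P. grad (local_loss P i m) x))"
  unfolding cumulative_loss_def[abs_def] task_loss_def[abs_def]
  using assms by (intro gderiv_sum gderiv_cmult gderiv_grad)

text \<open>Averaging over clients keeps the constant \<open>L\<close>, and summing over
  \<open>k\<close> tasks multiplies it by \<open>k\<close>.\<close>

lemma cumulative_loss_smooth:
  fixes P :: "('a::euclidean_space, 's) special"
  assumes diff: "\<And>i m x. i \<in> {1..k} \<Longrightarrow> m \<in> {1..num_clients P} \<Longrightarrow>
      local_loss P i m differentiable (at x)"
    and smooth: "\<And>i m x y. i \<in> {1..k} \<Longrightarrow> m \<in> {1..num_clients P} \<Longrightarrow>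
      norm (grad (local_loss P i m) x - grad (local_loss P i m) y) \<le> L * norm (x - y)"
    and clients: "num_clients P > 0"
  shows "norm (grad (cumulative_loss P k) x - grad (cumulative_loss P k) y) \<le> k * L * norm (x - y)"
proof -
  let ?M = "num_clients P" and ?g = "\<lambda>i m. grad (local_loss P i m)"
  have grad_eq: "grad (cumulative_loss P k) x = (\<Sum>i=1..k. (1 / ?M) *\<^sub>R (\<Sum>m=1..?M. ?g i m x))" for x
    by (rule grad_eqI[OF cumulative_loss_gderiv]) (rule diff)
  have "grad (cumulative_loss P k) x - grad (cumulative_loss P k) y =
      (\<Sum>i=1..k. (1 / ?M) *\<^sub>R (\<Sum>m=1..?M. ?g i m x - ?g i m y))"
    unfolding grad_eq
    by (simp add: sum_subtractf scaleR_right_diff_distrib)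
  also have "norm \<dots> \<le> (\<Sum>i=1..k. (1 / ?M) * (\<Sum>m=1..?M. L * norm (x - y)))"
  proof (intro order.trans[OF norm_sum] sum_mono)
    fix i assume i: "i \<in> {1..k}"
    have "norm (\<Sum>m=1..?M. ?g i m x - ?g i m y) \<le> (\<Sum>m=1..?M. L * norm (x - y))"
      using smooth[OF i] by (intro order.trans[OF norm_sum] sum_mono)
    then show "norm ((1 / ?M) *\<^sub>R (\<Sum>m=1..?M. ?g i m x - ?g i m y)) \<le>
        (1 / ?M) * (\<Sum>m=1..?M. L * norm (x - y))"
      unfolding norm_scaleR by (intro mult_mono) auto
  qed
  also have "\<dots> = k * L * norm (x - y)"
    using clients by simp
  finally show ?thesis .
qed

text \<open>Pure real arithmetic, with \<open>k\<close> for the number of old tasks,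
  \<open>u\<close> for the norm of the old gradient, \<open>A\<close> for the decay sum and
  \<open>a\<close> for the fraction bounding \<open>A\<^sup>2 / t\<close>. The first claim uses the
  rate conditions linearly, the second one squared.\<close>

lemma learning_rate_bounds:
  fixes A B E L M N a k t u \<epsilon> \<sigma> \<gamma>\<^sub>L \<gamma>\<^sub>G :: real
  assumes pos: "1 \<le> N" "1 \<le> M" "1 \<le> E" "1 \<le> t" "0 < B" "0 < L" "0 < a" "0 < k"
      "0 < \<gamma>\<^sub>L" "0 < \<gamma>\<^sub>G"
    and local_rate: "\<gamma>\<^sub>L \<le> 2 * \<epsilon> * u / (B * L * E * t * sqrt (M * E * a))"
    and global_rate: "\<gamma>\<^sub>G \<le> 1 / (sqrt N * k)"
    and A: "0 \<le> A" "A\<^sup>2 \<le> t * a"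
    and c: "c = k * L / 2 * (\<gamma>\<^sub>G * \<gamma>\<^sub>L) * (A * E)"
  shows "c * B \<le> \<epsilon> * u"
    and "\<gamma>\<^sub>G * \<gamma>\<^sub>L * (c * \<sigma>\<^sup>2 * (A * E)) \<le> 2 * \<epsilon>\<^sup>2 * \<sigma>\<^sup>2 * u\<^sup>2 / (k * t * E * M * N * L * B\<^sup>2)"
proof -
  let ?s = "sqrt (M * E * a)"
  have s: "0 < ?s" "?s\<^sup>2 = M * E * a"
    using pos by auto
  have l: "\<gamma>\<^sub>L * (B * L * E * t * ?s) \<le> 2 * \<epsilon> * u"
    using local_rate pos s by (simp add: pos_le_divide_eq)
  have g: "\<gamma>\<^sub>G * (sqrt N * k) \<le> 1"
    using global_rate pos by (simp add: pos_le_divide_eq)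
  \<comment> \<open>As \<open>t * M * E\<close> is at least one, the bound on
    \<open>A\<^sup>2\<close> is weakened to the quantity in the local rate condition.\<close>
  have "t * a \<le> (t * ?s)\<^sup>2"
  proof -
    have "t * a * 1 \<le> t * a * (t * (M * E))"
      using pos mult_mono[of 1 t 1 "M * E"] mult_mono[of 1 M 1 E] by (intro mult_left_mono) auto
    then show ?thesis
      unfolding power_mult_distrib s(2) by (simp add: power2_eq_square algebra_simps)
  qed
  then have "A\<^sup>2 \<le> (t * ?s)\<^sup>2"
    using A by linarith
  then have A_le: "A \<le> t * ?s"
    by (rule power2_le_imp_le) (use pos in auto)
  \<comment> \<open>The factor \<open>sqrt N\<close> is dropped here; the noise estimate below keeps
    it to obtain the \<open>N\<close> in the denominator.\<close>
  have "\<gamma>\<^sub>G * k \<le> 1"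
  proof -
    have "\<gamma>\<^sub>G * (1 * k) \<le> \<gamma>\<^sub>G * (sqrt N * k)"
      using pos by (intro mult_left_mono mult_right_mono) auto
    with g show ?thesis by simp
  qed
  then have "(\<gamma>\<^sub>G * k) * (\<gamma>\<^sub>L * (B * L * E * A)) \<le> 1 * (\<gamma>\<^sub>L * (B * L * E * (t * ?s)))"
    using pos A A_le by (intro mult_mono mult_left_mono) auto
  with l show "c * B \<le> \<epsilon> * u"
    by (simp add: c algebra_simps)
  have l2: "(\<gamma>\<^sub>L * (B * L * E * t * ?s))\<^sup>2 \<le> (2 * \<epsilon> * u)\<^sup>2"
    using l pos s by (intro power_mono) auto
  have g2: "(\<gamma>\<^sub>G * (sqrt N * k))\<^sup>2 \<le> 1"
    using g pos by (simp add: power_le_one)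
  \<comment> \<open>With the denominator cleared and \<open>A\<^sup>2\<close> replaced by
    \<open>t * a\<close>, what remains is exactly the product of the two squared rate
    conditions.\<close>
  have "\<gamma>\<^sub>G * \<gamma>\<^sub>L * (c * \<sigma>\<^sup>2 * (A * E)) * (k * t * E * M * N * L * B\<^sup>2) =
      \<sigma>\<^sup>2 / 2 * (k\<^sup>2 * L\<^sup>2 * \<gamma>\<^sub>G\<^sup>2 * \<gamma>\<^sub>L\<^sup>2 * E\<^sup>2 * t * E * M * N * B\<^sup>2) * A\<^sup>2"
    by (simp add: c power2_eq_square)
  also have "\<dots> \<le> \<sigma>\<^sup>2 / 2 * (k\<^sup>2 * L\<^sup>2 * \<gamma>\<^sub>G\<^sup>2 * \<gamma>\<^sub>L\<^sup>2 * E\<^sup>2 * t * E * M * N * B\<^sup>2) * (t * a)"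
    using pos A by (intro mult_left_mono) auto
  also have "\<dots> = \<sigma>\<^sup>2 / 2 * ((\<gamma>\<^sub>G * (sqrt N * k))\<^sup>2 * (\<gamma>\<^sub>L * (B * L * E * t * ?s))\<^sup>2)"
    unfolding power_mult_distrib s(2) using pos by (simp add: power2_eq_square)
  also have "\<dots> \<le> \<sigma>\<^sup>2 / 2 * (1 * (2 * \<epsilon> * u)\<^sup>2)"
    using l2 g2 by (intro mult_left_mono mult_mono) auto
  also have "\<dots> = 2 * \<epsilon>\<^sup>2 * \<sigma>\<^sup>2 * u\<^sup>2"
    by (simp add: power2_eq_square)
  finally show "\<gamma>\<^sub>G * \<gamma>\<^sub>L * (c * \<sigma>\<^sup>2 * (A * E)) \<le>
      2 * \<epsilon>\<^sup>2 * \<sigma>\<^sup>2 * u\<^sup>2 / (k * t * E * M * N * L * B\<^sup>2)"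
    using pos by (subst pos_le_divide_eq) auto
qed

theorem theorem4p7:
  fixes P :: "(real ^ 'd, 's) special"
    and h :: "nat \<Rightarrow> 's draws"
    and K M N E T t :: nat
    and lam \<gamma>\<^sub>L \<gamma>\<^sub>G B L \<sigma>\<^sub>L \<sigma>\<^sub>G \<sigma>\<^sub>T \<epsilon> :: real
    and \<theta>\<^sub>K\<^sub>0 :: "real ^ 'd"
  assumes parameters:
      "num_tasks P = K" "num_clients P = M" "num_participants P = N"
      "num_epochs P = E" "num_rounds P = T"
      "prox_weight P = lam" "local_lr P = \<gamma>\<^sub>L" "global_lr P = \<gamma>\<^sub>G"
    and ranges: "K \<ge> 2" "1 \<le> N" "N \<le> M" "E \<ge> 1" "T \<ge> 1" "lam > 0" "\<gamma>\<^sub>L > 0" "\<gamma>\<^sub>G > 0"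
      "B > 0" "L > 0"
    and data: "\<And>i m. i \<in> {1..K} \<Longrightarrow> m \<in> {1..M} \<Longrightarrow> prob_space (data_distr P i m)"
    and loss_integrable: "\<And>i m \<theta>. i \<in> {1..K} \<Longrightarrow> m \<in> {1..M} \<Longrightarrow>
      integrable (data_distr P i m) (sample_loss P i m \<theta>)"
    and sample_loss_differentiable: "\<And>i m \<theta> \<xi>. i \<in> {1..K} \<Longrightarrow> m \<in> {1..M} \<Longrightarrow>
      \<xi> \<in> space (data_distr P i m) \<Longrightarrow> (\<lambda>x. sample_loss P i m x \<xi>) differentiable (at \<theta>)"
    and local_loss_differentiable: "\<And>i m \<theta>. i \<in> {1..K} \<Longrightarrow> m \<in> {1..M} \<Longrightarrow>
      local_loss P i m differentiable (at \<theta>)"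
    and history: "\<And>i. i \<in> {1..<K} \<Longrightarrow> h i \<in> space (draws_measure P i)"
    and start: "\<theta>\<^sub>K\<^sub>0 = final_model P h (K - 1)"
    and A1: "\<And>i m \<theta> \<xi>. i \<in> {1..K} \<Longrightarrow> m \<in> {1..M} \<Longrightarrow> \<xi> \<in> space (data_distr P i m) \<Longrightarrow>
      norm (stoch_grad P i m \<theta> \<xi>) \<le> B"
    and A2: "\<And>i m \<theta> \<theta>'. i \<in> {1..K} \<Longrightarrow> m \<in> {1..M} \<Longrightarrow>
      norm (grad (local_loss P i m) \<theta> - grad (local_loss P i m) \<theta>') \<le> L * norm (\<theta> - \<theta>')"
    and A3: "\<And>i m \<tau> e. i \<in> {1..K} \<Longrightarrow> m \<in> {1..M} \<Longrightarrow> \<tau> < T \<Longrightarrow> e < E \<Longrightarrow>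
      AE \<kappa> in draws_measure P K. unbiased_at P i m (local_model P (h(K := \<kappa>)) i m \<tau> e)"
    and A4: "\<And>i m \<tau> e. i \<in> {1..K} \<Longrightarrow> m \<in> {1..M} \<Longrightarrow> \<tau> < T \<Longrightarrow> e < E \<Longrightarrow>
      AE \<kappa> in draws_measure P K.
        variance_bounded_at P \<sigma>\<^sub>L i m (local_model P (h(K := \<kappa>)) i m \<tau> e)"
    and A5: "\<And>i m \<tau>. i \<in> {1..K} \<Longrightarrow> m \<in> {1..M} \<Longrightarrow> \<tau> < T \<Longrightarrow>
      AE \<kappa> in draws_measure P K.
        (norm (grad (local_loss P i m) (global_model P (h(K := \<kappa>)) i \<tau>)
               - grad (task_loss P i) (global_model P (h(K := \<kappa>)) i \<tau>)))\<^sup>2 \<le> \<sigma>\<^sub>G\<^sup>2"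
    and A6: "\<And>i j \<theta>. i \<in> {1..K} \<Longrightarrow> j \<in> {1..K} \<Longrightarrow>
      (norm (grad (task_loss P i) \<theta> - grad (task_loss P j) \<theta>))\<^sup>2 \<le> \<sigma>\<^sub>T\<^sup>2"
    and t: "1 \<le> t" "t \<le> T"
    and eps: "0 < \<epsilon>" "\<epsilon> < 1"
    and alignment: "\<And>\<tau> e m. \<tau> < t \<Longrightarrow> e < E \<Longrightarrow> m \<in> {1..M} \<Longrightarrow>
      AE \<kappa> in draws_measure P K.
        grad (cumulative_loss P (K - 1)) \<theta>\<^sub>K\<^sub>0
          \<bullet> grad (local_loss P K m) (local_model P (h(K := \<kappa>)) K m \<tau> e)
        \<ge> \<epsilon> * norm (grad (cumulative_loss P (K - 1)) \<theta>\<^sub>K\<^sub>0)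
            * norm (grad (local_loss P K m) (local_model P (h(K := \<kappa>)) K m \<tau> e))"
    and local_rate: "\<gamma>\<^sub>L \<le> 2 * \<epsilon> * norm (grad (cumulative_loss P (K - 1)) \<theta>\<^sub>K\<^sub>0)
      / (B * L * real E * real t * sqrt (real M * real E * (1 / (lam\<^sup>2 + 2 * lam))))"
    and global_rate: "\<gamma>\<^sub>G \<le> 1 / (sqrt (real N) * (real K - 1))"
  shows "(\<integral>\<kappa>. cumulative_loss P (K - 1) (global_model P (h(K := \<kappa>)) K t) \<partial>draws_measure P K)
    \<le> cumulative_loss P (K - 1) \<theta>\<^sub>K\<^sub>0
      + 2 * \<epsilon>\<^sup>2 * \<sigma>\<^sub>L\<^sup>2 * (norm (grad (cumulative_loss P (K - 1)) \<theta>\<^sub>K\<^sub>0))\<^sup>2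
        / ((real K - 1) * real t * real E * real M * real N * L * B\<^sup>2)"
proof -
  have K: "K \<in> {1..K}" and M: "0 < M"
    using ranges by auto
  interpret special_task P K B \<theta>\<^sub>K\<^sub>0
  proof (rule special_task.intro)
    fix m assume m: "m \<in> {1..num_clients P}"
    show "prob_space (data_distr P K m)"
      using data[OF K] m parameters by simp
    show "sample_loss P K m \<theta> \<in> borel_measurable (data_distr P K m)" for \<theta>
      using loss_integrable[OF K] m parameters by (intro borel_measurable_integrable) simp
    show "(\<lambda>x. sample_loss P K m x \<xi>) differentiable (at \<theta>)"
      if "\<xi> \<in> space (data_distr P K m)" for \<theta> \<xi>
      using sample_loss_differentiable[OF K _ that] m parameters by simp
    show "norm (stoch_grad P K m \<theta> \<xi>) \<le> B" if "\<xi> \<in> space (data_distr P K m)" for \<theta> \<xi>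
      using A1[OF K _ that] m parameters by simp
  qed (use ranges parameters in auto)
  let ?F = "cumulative_loss P (K - 1)"
  have task: "i \<in> {1..K}" if "i \<in> {1..K - 1}" for i
    using that by auto
  have k: "real (K - 1) = real K - 1"
    using ranges by simp
  \<comment> \<open>Conditioning on the start of task \<open>K\<close> amounts to fixing the
    history: \<open>h(K := \<kappa>)\<close> changes the draws of task \<open>K\<close> only, so
    every \<open>\<kappa>\<close> has the same start.\<close>
  have "final_model P (h(K := \<kappa>)) (K - 1) = \<theta>\<^sub>K\<^sub>0" for \<kappa>
    unfolding start by (rule final_model_cong) auto
  then have global: "global_model P (h(K := \<kappa>)) K t = task_model P K \<kappa> \<theta>\<^sub>K\<^sub>0 t" for \<kappa> t
    by (simp add: global_model_def)
  have local: "local_model P (h(K := \<kappa>)) K m \<tau> e = local_iterate \<kappa> \<tau> m e" for \<kappa> m \<tau> e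
    by (simp add: local_model_def local_iterate_def global)
  have F: "GDERIV ?F x :> grad ?F x" for x
    using cumulative_loss_gderiv[of "K - 1" P x] local_loss_differentiable[OF task] parameters
    by (intro gderiv_grad) (auto simp: gderiv_def differentiable_def)
  have smooth: "norm (grad ?F x - grad ?F y) \<le> (real K - 1) * L * norm (x - y)" for x y
    using cumulative_loss_smooth[of "K - 1" P L x y] local_loss_differentiable[OF task] A2[OF task]
      parameters M k by simp
  have signs: "0 \<le> (real K - 1) * L" "0 \<le> \<gamma>\<^sub>G * \<gamma>\<^sub>L"
      "\<gamma>\<^sub>G * \<gamma>\<^sub>L = global_lr P * local_lr P" "0 < prox_weight P" "t \<le> num_rounds P"
    using ranges t parameters by auto
  \<comment> \<open>The constant of \<open>expected_loss_le\<close> for the smoothness constant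
    \<open>(K - 1) * L\<close> of the old loss.\<close>
  define c where "c = (real K - 1) * L / 2 * (\<gamma>\<^sub>G * \<gamma>\<^sub>L) * (decay_sum t * num_epochs P)"
  note rates = learning_rate_bounds[of N M E t B L "1 / (lam\<^sup>2 + 2 * lam)" "real K - 1" \<gamma>\<^sub>L \<gamma>\<^sub>G \<epsilon>
    "norm (grad ?F \<theta>\<^sub>K\<^sub>0)" "decay_sum t" c]
  have a: "0 < 1 / (lam\<^sup>2 + 2 * lam)"
    using ranges by (simp add: add_pos_pos)
  have cB: "c * B \<le> \<epsilon> * norm (grad ?F \<theta>\<^sub>K\<^sub>0)"
    using ranges t local_rate global_rate decay_sum_bounds[OF signs(4), of t] a parameters
    by (intro rates(1)) (auto simp: c_def)
  have noise: "\<gamma>\<^sub>G * \<gamma>\<^sub>L * (c * \<sigma>\<^sub>L\<^sup>2 * (decay_sum t * E)) \<le> 2 * \<epsilon>\<^sup>2 * \<sigma>\<^sub>L\<^sup>2 * (norm (grad ?F \<theta>\<^sub>K\<^sub>0))\<^sup>2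
      / ((real K - 1) * real t * real E * real M * real N * L * B\<^sup>2)"
    using ranges t local_rate global_rate decay_sum_bounds[OF signs(4), of t] a parameters
    by (intro rates(2)) (auto simp: c_def)
  have "(\<integral>\<kappa>. ?F (task_model P K \<kappa> \<theta>\<^sub>K\<^sub>0 t) \<partial>draws_measure P K) \<le>
      ?F \<theta>\<^sub>K\<^sub>0 + \<gamma>\<^sub>G * \<gamma>\<^sub>L * (c * \<sigma>\<^sub>L\<^sup>2 * (decay_sum t * num_epochs P))"
    using signs c_def cB
  proof (rule expected_loss_le[OF F smooth])
    fix \<tau> m e assume *: "\<tau> < t" "m \<in> {1..num_clients P}" "e < num_epochs P"
    then have "\<tau> < T" "m \<in> {1..M}" "e < E"
      using t parameters by auto
    then show "AE \<kappa> in draws_measure P K. unbiased_at P K m (local_iterate \<kappa> \<tau> m e)"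
      and "AE \<kappa> in draws_measure P K. variance_bounded_at P \<sigma>\<^sub>L K m (local_iterate \<kappa> \<tau> m e)"
      and "AE \<kappa> in draws_measure P K. \<epsilon> * norm (grad ?F \<theta>\<^sub>K\<^sub>0)
          * norm (grad (local_loss P K m) (local_iterate \<kappa> \<tau> m e))
        \<le> grad ?F \<theta>\<^sub>K\<^sub>0 \<bullet> grad (local_loss P K m) (local_iterate \<kappa> \<tau> m e)"
      using A3[OF K, of m \<tau> e] A4[OF K, of m \<tau> e] alignment[OF *(1), of e m] by (simp_all add: local)
  qed
  then show ?thesis
    using noise unfolding global parameters by linarith
qed

end
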